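(* Let $m,r>0$ and let $\mathbb{I}=\mathrm{diag}(I_1,I_2,I_3)$ with $I_1,I_2,I_3>0$. On $\mathcal{R}=S^2\times\mathbb{R}^3$, with elements $(\gamma,K)$, $\|\gamma\|=1$, let $\Omega=\Omega(\gamma,K)\in\mathbb{R}^3$ be determined by $K=\mathbb{I}\Omega+mr^2(\Omega\cdot\gamma)\gamma$, and consider the almost Poisson bracket $$\{f,g\}_{\mathrm{Rank}1}=-\bigl(K+mr^2(\Omega\cdot\gamma)\gamma\bigr)\cdot\left(\frac{\partial f}{\partial K}\times\frac{\partial g}{\partial K}\right)-\gamma\cdot\left(\frac{\partial f}{\partial K}\times\frac{\partial g}{\partial\gamma}-\frac{\partial g}{\partial K}\times\frac{\partial f}{\partial\gamma}\right).$$ Then $\{\cdot,\cdot\}_{\mathrm{Rank}1}$ is a $\phi$-twisted Poisson bracket with $\phi=d\mathcal{B}$, where $\mathcal{B}=mr^2(\Omega\cdot\gamma)\,\sigma$ and $\sigma$ denotes the area form of the sphere $\|\gamma\|=1$.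
   Context: An almost Poisson bracket is a skew-symmetric bilinear bracket on smooth functions satisfying the Leibniz rule (not necessarily the Jacobi identity). The formula is written in the redundant coordinates $(\gamma,K)\in\mathbb{R}^3\times\mathbb{R}^3$; since $\|\gamma\|^2$ is a Casimir function, it restricts to $\mathcal{R}=\{\|\gamma\|=1\}=S^2\times\mathbb{R}^3$. The area form $\sigma$ (pulled back to $\mathcal{R}$) is $\sigma=\frac12\gamma\cdot(d\gamma\times d\gamma)$, i.e. $\sigma(u,v)=\gamma\cdot(u\times v)$ for $u,v\in T_\gamma S^2$. Twisted Poisson. For a bracket $\{\cdot,\cdot\}$ on a manifold $P$, the associated bivector field $\pi$ satisfies $\pi(df,dg)=\{f,g\}$, and $\pi^\sharp:T^*P\to TP$ is given by $\beta(\pi^\sharp(\alpha))=\pi(\alpha,\beta)$. For a closed 3-form $\phi$ on $P$, the $\phi$-twisted Courant bracket on $\Gamma(TP\oplus T^*P)$ is $[\![(X,\alpha),(Y,\beta)]\!]_\phi=([X,Y],\mathcal{L}_X\beta-\mathbf{i}_Yd\alpha+\mathbf{i}_{X\wedge Y}\phi)$, with $\mathbf{i}_{X\wedge Y}\phi=\phi(X,Y,\cdot)$. The bracket (or $\pi$) is $\phi$-twisted Poisson if $L_\pi=\{(\pi^\sharp(\alpha),\alpha)\}\subset TP\oplus T^*P$ satisfies $[\![\Gamma(L_\pi),\Gamma(L_\pi)]\!]_\phi\subseteq\Gamma(L_\pi)$. *)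

theory Defs
  imports "HOL-Analysis.Analysis"
begin

unbundle cross3_syntax

section \<open>Calculus on embedded submanifolds of a Euclidean space\<close>

text \<open>
  In this section \<open>M\<close> stands for a smooth embedded submanifold (without boundary) of a Euclidean
  space; the definitions are only meant to be used for such \<open>M\<close>. Values of functions,
  fields and forms at points outside \<open>M\<close> never matter.
\<close>

primrec Ck_on :: "nat \<Rightarrow> 'a::euclidean_space set \<Rightarrow> ('a \<Rightarrow> 'b::real_normed_vector) \<Rightarrow> bool" where
  "Ck_on 0 U F \<longleftrightarrow> continuous_on U F"
| "Ck_on (Suc k) U F \<longleftrightarrow>
     (\<forall>x\<in>U. F differentiable (at x)) \<and> (\<forall>v. Ck_on k U (\<lambda>x. frechet_derivative F (at x) v))"

definition Cinf_on :: "'a::euclidean_space set \<Rightarrow> ('a \<Rightarrow> 'b::real_normed_vector) \<Rightarrow> bool" where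
  "Cinf_on U F \<longleftrightarrow> (\<forall>k. Ck_on k U F)"

definition local_extension ::
    "'a::euclidean_space set \<Rightarrow> 'a \<Rightarrow> ('a \<Rightarrow> 'b::real_normed_vector) \<Rightarrow> ('a \<Rightarrow> 'b) \<Rightarrow> bool" where
  "local_extension M p f F \<longleftrightarrow>
     (\<exists>U. open U \<and> p \<in> U \<and> Cinf_on U F \<and> (\<forall>q\<in>M \<inter> U. F q = f q))"

definition smooth_map :: "'a::euclidean_space set \<Rightarrow> ('a \<Rightarrow> 'b::real_normed_vector) \<Rightarrow> bool" where
  "smooth_map M f \<longleftrightarrow> (\<forall>p\<in>M. \<exists>F. local_extension M p f F)"

definition tangent_space :: "'a::euclidean_space set \<Rightarrow> 'a \<Rightarrow> 'a set" where
  "tangent_space M p =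
     {v. \<exists>c :: real \<Rightarrow> 'a. Cinf_on UNIV c \<and> range c \<subseteq> M \<and> c 0 = p \<and> (c has_vector_derivative v) (at 0)}"

text \<open>A covector at \<open>p\<close> is a linear functional on the tangent space, extended by \<open>0\<close> to all other
  vectors so that equality of covectors is equality of functions.\<close>

definition cotangent_space :: "'a::euclidean_space set \<Rightarrow> 'a \<Rightarrow> ('a \<Rightarrow> real) set" where
  "cotangent_space M p =
     {a. (\<forall>u\<in>tangent_space M p. \<forall>v\<in>tangent_space M p. a (u + v) = a u + a v) \<and>
         (\<forall>t. \<forall>u\<in>tangent_space M p. a (t *\<^sub>R u) = t * a u) \<and>
         (\<forall>v. v \<notin> tangent_space M p \<longrightarrow> a v = 0)}"

definition vector_fields :: "'a::euclidean_space set \<Rightarrow> ('a \<Rightarrow> 'a) set" where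
  "vector_fields M = {X. smooth_map M X \<and> (\<forall>p\<in>M. X p \<in> tangent_space M p)}"

definition one_forms :: "'a::euclidean_space set \<Rightarrow> ('a \<Rightarrow> 'a \<Rightarrow> real) set" where
  "one_forms M = {\<alpha>. (\<forall>p\<in>M. \<alpha> p \<in> cotangent_space M p) \<and>
                      (\<forall>X\<in>vector_fields M. smooth_map M (\<lambda>p. \<alpha> p (X p)))}"

definition three_forms :: "'a::euclidean_space set \<Rightarrow> ('a \<Rightarrow> 'a \<Rightarrow> 'a \<Rightarrow> 'a \<Rightarrow> real) set" where
  "three_forms M = {\<phi>.
     (\<forall>p\<in>M. \<forall>u\<in>tangent_space M p. \<forall>v\<in>tangent_space M p. \<forall>w\<in>tangent_space M p.
        (\<forall>u'\<in>tangent_space M p. \<forall>s t. \<phi> p (s *\<^sub>R u + t *\<^sub>R u') v w = s * \<phi> p u v w + t * \<phi> p u' v w) \<and>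
        \<phi> p v u w = - \<phi> p u v w \<and> \<phi> p u w v = - \<phi> p u v w) \<and>
     (\<forall>X\<in>vector_fields M. \<forall>Y\<in>vector_fields M. \<forall>Z\<in>vector_fields M.
        smooth_map M (\<lambda>p. \<phi> p (X p) (Y p) (Z p)))}"

text \<open>For a smooth map \<open>f\<close> on \<open>M\<close> all derivatives of \<open>f\<close> at \<open>p\<close> within \<open>M\<close> agree on the tangent space
  at \<open>p\<close>, so the choice made by \<open>frechet_derivative\<close> is immaterial below.\<close>

definition differential :: "'a::euclidean_space set \<Rightarrow> ('a \<Rightarrow> real) \<Rightarrow> 'a \<Rightarrow> 'a \<Rightarrow> real" where
  "differential M f p v = (if v \<in> tangent_space M p then frechet_derivative f (at p within M) v else 0)"

definition deriv_along ::
    "'a::euclidean_space set \<Rightarrow> ('a \<Rightarrow> 'a) \<Rightarrow> ('a \<Rightarrow> 'b::real_normed_vector) \<Rightarrow> 'a \<Rightarrow> 'b" where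
  "deriv_along M X f p = frechet_derivative f (at p within M) (X p)"

definition lie_bracket :: "'a::euclidean_space set \<Rightarrow> ('a \<Rightarrow> 'a) \<Rightarrow> ('a \<Rightarrow> 'a) \<Rightarrow> 'a \<Rightarrow> 'a" where
  "lie_bracket M X Y p = deriv_along M X Y p - deriv_along M Y X p"

text \<open>Exterior and Lie derivatives are given by the invariant (Koszul) formulas on vector fields. These
  are tensorial, so their pointwise values may be computed with any vector fields extending
  the given tangent vectors; \<open>extend_vector\<close> picks such fields.\<close>

definition extend_vector :: "'a::euclidean_space set \<Rightarrow> 'a \<Rightarrow> 'a \<Rightarrow> 'a \<Rightarrow> 'a" where
  "extend_vector M p v = (SOME X. X \<in> vector_fields M \<and> X p = v)"

definition ext_deriv1_fields ::
    "'a::euclidean_space set \<Rightarrow> ('a \<Rightarrow> 'a \<Rightarrow> real) \<Rightarrow> ('a \<Rightarrow> 'a) \<Rightarrow> ('a \<Rightarrow> 'a) \<Rightarrow> 'a \<Rightarrow> real" where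
  "ext_deriv1_fields M \<alpha> X Y p =
     deriv_along M X (\<lambda>q. \<alpha> q (Y q)) p - deriv_along M Y (\<lambda>q. \<alpha> q (X q)) p
     - \<alpha> p (lie_bracket M X Y p)"

definition ext_deriv1 ::
    "'a::euclidean_space set \<Rightarrow> ('a \<Rightarrow> 'a \<Rightarrow> real) \<Rightarrow> 'a \<Rightarrow> 'a \<Rightarrow> 'a \<Rightarrow> real" where
  "ext_deriv1 M \<alpha> p u v = ext_deriv1_fields M \<alpha> (extend_vector M p u) (extend_vector M p v) p"

definition ext_deriv2_fields ::
    "'a::euclidean_space set \<Rightarrow> ('a \<Rightarrow> 'a \<Rightarrow> 'a \<Rightarrow> real) \<Rightarrow>
      ('a \<Rightarrow> 'a) \<Rightarrow> ('a \<Rightarrow> 'a) \<Rightarrow> ('a \<Rightarrow> 'a) \<Rightarrow> 'a \<Rightarrow> real" where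
  "ext_deriv2_fields M \<omega> X Y Z p =
     deriv_along M X (\<lambda>q. \<omega> q (Y q) (Z q)) p
     - deriv_along M Y (\<lambda>q. \<omega> q (X q) (Z q)) p
     + deriv_along M Z (\<lambda>q. \<omega> q (X q) (Y q)) p
     - \<omega> p (lie_bracket M X Y p) (Z p)
     + \<omega> p (lie_bracket M X Z p) (Y p)
     - \<omega> p (lie_bracket M Y Z p) (X p)"

definition ext_deriv2 ::
    "'a::euclidean_space set \<Rightarrow> ('a \<Rightarrow> 'a \<Rightarrow> 'a \<Rightarrow> real) \<Rightarrow> 'a \<Rightarrow> 'a \<Rightarrow> 'a \<Rightarrow> 'a \<Rightarrow> real" where
  "ext_deriv2 M \<omega> p u v w =
     ext_deriv2_fields M \<omega> (extend_vector M p u) (extend_vector M p v) (extend_vector M p w) p"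

definition ext_deriv3_fields ::
    "'a::euclidean_space set \<Rightarrow> ('a \<Rightarrow> 'a \<Rightarrow> 'a \<Rightarrow> 'a \<Rightarrow> real) \<Rightarrow>
      ('a \<Rightarrow> 'a) \<Rightarrow> ('a \<Rightarrow> 'a) \<Rightarrow> ('a \<Rightarrow> 'a) \<Rightarrow> ('a \<Rightarrow> 'a) \<Rightarrow> 'a \<Rightarrow> real" where
  "ext_deriv3_fields M \<phi> X Y Z W p =
     deriv_along M X (\<lambda>q. \<phi> q (Y q) (Z q) (W q)) p
     - deriv_along M Y (\<lambda>q. \<phi> q (X q) (Z q) (W q)) p
     + deriv_along M Z (\<lambda>q. \<phi> q (X q) (Y q) (W q)) p
     - deriv_along M W (\<lambda>q. \<phi> q (X q) (Y q) (Z q)) p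
     - \<phi> p (lie_bracket M X Y p) (Z p) (W p)
     + \<phi> p (lie_bracket M X Z p) (Y p) (W p)
     - \<phi> p (lie_bracket M X W p) (Y p) (Z p)
     - \<phi> p (lie_bracket M Y Z p) (X p) (W p)
     + \<phi> p (lie_bracket M Y W p) (X p) (Z p)
     - \<phi> p (lie_bracket M Z W p) (X p) (Y p)"

definition closed_three_form :: "'a::euclidean_space set \<Rightarrow> ('a \<Rightarrow> 'a \<Rightarrow> 'a \<Rightarrow> 'a \<Rightarrow> real) \<Rightarrow> bool" where
  "closed_three_form M \<phi> \<longleftrightarrow> \<phi> \<in> three_forms M \<and>
     (\<forall>X\<in>vector_fields M. \<forall>Y\<in>vector_fields M. \<forall>Z\<in>vector_fields M. \<forall>W\<in>vector_fields M.
        \<forall>p\<in>M. ext_deriv3_fields M \<phi> X Y Z W p = 0)"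

definition lie_deriv1_fields ::
    "'a::euclidean_space set \<Rightarrow> ('a \<Rightarrow> 'a) \<Rightarrow> ('a \<Rightarrow> 'a \<Rightarrow> real) \<Rightarrow> ('a \<Rightarrow> 'a) \<Rightarrow> 'a \<Rightarrow> real" where
  "lie_deriv1_fields M X \<beta> W p =
     deriv_along M X (\<lambda>q. \<beta> q (W q)) p - \<beta> p (lie_bracket M X W p)"

definition lie_deriv1 ::
    "'a::euclidean_space set \<Rightarrow> ('a \<Rightarrow> 'a) \<Rightarrow> ('a \<Rightarrow> 'a \<Rightarrow> real) \<Rightarrow> 'a \<Rightarrow> 'a \<Rightarrow> real" where
  "lie_deriv1 M X \<beta> p w = lie_deriv1_fields M X \<beta> (extend_vector M p w) p"


section \<open>Almost Poisson brackets and twisted Poisson brackets\<close>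

definition almost_poisson_bracket ::
    "'a::euclidean_space set \<Rightarrow> (('a \<Rightarrow> real) \<Rightarrow> ('a \<Rightarrow> real) \<Rightarrow> 'a \<Rightarrow> real) \<Rightarrow> bool" where
  "almost_poisson_bracket M br \<longleftrightarrow>
     (\<forall>f g. smooth_map M f \<longrightarrow> smooth_map M g \<longrightarrow>
        smooth_map M (br f g) \<and> (\<forall>p\<in>M. br g f p = - br f g p) \<and>
        (\<forall>h. smooth_map M h \<longrightarrow>
           (\<forall>p\<in>M. (\<forall>s t. br (\<lambda>q. s * f q + t * g q) h p = s * br f h p + t * br g h p) \<and>
                  br (\<lambda>q. f q * g q) h p = f p * br g h p + g p * br f h p)))"

definition bivector_field ::
    "'a::euclidean_space set \<Rightarrow> ('a \<Rightarrow> ('a \<Rightarrow> real) \<Rightarrow> ('a \<Rightarrow> real) \<Rightarrow> real) \<Rightarrow> bool" where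
  "bivector_field M \<pi> \<longleftrightarrow>
     (\<forall>p\<in>M. \<forall>a\<in>cotangent_space M p. \<forall>b\<in>cotangent_space M p.
        \<pi> p b a = - \<pi> p a b \<and>
        (\<forall>a'\<in>cotangent_space M p. \<forall>s t.
           \<pi> p (\<lambda>v. s * a v + t * a' v) b = s * \<pi> p a b + t * \<pi> p a' b)) \<and>
     (\<forall>\<alpha>\<in>one_forms M. \<forall>\<beta>\<in>one_forms M. smooth_map M (\<lambda>p. \<pi> p (\<alpha> p) (\<beta> p)))"

definition bivector_of_bracket ::
    "'a::euclidean_space set \<Rightarrow> (('a \<Rightarrow> real) \<Rightarrow> ('a \<Rightarrow> real) \<Rightarrow> 'a \<Rightarrow> real) \<Rightarrow>
      ('a \<Rightarrow> ('a \<Rightarrow> real) \<Rightarrow> ('a \<Rightarrow> real) \<Rightarrow> real) \<Rightarrow> bool" where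
  "bivector_of_bracket M br \<pi> \<longleftrightarrow> bivector_field M \<pi> \<and>
     (\<forall>f g. smooth_map M f \<longrightarrow> smooth_map M g \<longrightarrow>
        (\<forall>p\<in>M. \<pi> p (differential M f p) (differential M g p) = br f g p))"

definition sharp ::
    "'a::euclidean_space set \<Rightarrow> ('a \<Rightarrow> ('a \<Rightarrow> real) \<Rightarrow> ('a \<Rightarrow> real) \<Rightarrow> real) \<Rightarrow> 'a \<Rightarrow> ('a \<Rightarrow> real) \<Rightarrow> 'a" where
  "sharp M \<pi> p a = (THE v. v \<in> tangent_space M p \<and> (\<forall>b\<in>cotangent_space M p. b v = \<pi> p a b))"

definition graph_fibre ::
    "'a::euclidean_space set \<Rightarrow> ('a \<Rightarrow> ('a \<Rightarrow> real) \<Rightarrow> ('a \<Rightarrow> real) \<Rightarrow> real) \<Rightarrow> 'a \<Rightarrow> ('a \<times> ('a \<Rightarrow> real)) set" where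
  "graph_fibre M \<pi> p = {(sharp M \<pi> p a, a) | a. a \<in> cotangent_space M p}"

definition graph_sections ::
    "'a::euclidean_space set \<Rightarrow> ('a \<Rightarrow> ('a \<Rightarrow> real) \<Rightarrow> ('a \<Rightarrow> real) \<Rightarrow> real) \<Rightarrow>
      (('a \<Rightarrow> 'a) \<times> ('a \<Rightarrow> 'a \<Rightarrow> real)) set" where
  "graph_sections M \<pi> = {(X, \<alpha>). X \<in> vector_fields M \<and> \<alpha> \<in> one_forms M \<and>
                                 (\<forall>p\<in>M. (X p, \<alpha> p) \<in> graph_fibre M \<pi> p)}"

definition courant_bracket ::
    "'a::euclidean_space set \<Rightarrow> ('a \<Rightarrow> 'a \<Rightarrow> 'a \<Rightarrow> 'a \<Rightarrow> real) \<Rightarrow>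
      ('a \<Rightarrow> 'a) \<times> ('a \<Rightarrow> 'a \<Rightarrow> real) \<Rightarrow> ('a \<Rightarrow> 'a) \<times> ('a \<Rightarrow> 'a \<Rightarrow> real) \<Rightarrow>
      ('a \<Rightarrow> 'a) \<times> ('a \<Rightarrow> 'a \<Rightarrow> real)" where
  "courant_bracket M \<phi> = (\<lambda>(X, \<alpha>) (Y, \<beta>).
     (lie_bracket M X Y,
      \<lambda>p w. if w \<in> tangent_space M p
            then lie_deriv1 M X \<beta> p w - ext_deriv1 M \<alpha> p (Y p) w + \<phi> p (X p) (Y p) w
            else 0))"

text \<open>The bivector field of an almost Poisson bracket is unique on covectors, so
  \<open>\<exists>\<pi>\<close> here means ``the associated bivector field''.\<close>

definition twisted_poisson_bracket ::
    "'a::euclidean_space set \<Rightarrow> (('a \<Rightarrow> real) \<Rightarrow> ('a \<Rightarrow> real) \<Rightarrow> 'a \<Rightarrow> real) \<Rightarrow>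
      ('a \<Rightarrow> 'a \<Rightarrow> 'a \<Rightarrow> 'a \<Rightarrow> real) \<Rightarrow> bool" where
  "twisted_poisson_bracket M br \<phi> \<longleftrightarrow>
     almost_poisson_bracket M br \<and> closed_three_form M \<phi> \<and>
     (\<exists>\<pi>. bivector_of_bracket M br \<pi> \<and>
        (\<forall>e1\<in>graph_sections M \<pi>. \<forall>e2\<in>graph_sections M \<pi>.
           courant_bracket M \<phi> e1 e2 \<in> graph_sections M \<pi>))"


section \<open>The rank one bracket\<close>

type_synonym vec3 = "real^3"

definition reduced_space :: "(vec3 \<times> vec3) set" where
  "reduced_space = {(\<gamma>, K). norm \<gamma> = 1}"

definition diag3 :: "real \<Rightarrow> real \<Rightarrow> real \<Rightarrow> real^3^3" where
  "diag3 a b c = vector [vector [a, 0, 0], vector [0, b, 0], vector [0, 0, c]]"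

definition Omega :: "real \<Rightarrow> real \<Rightarrow> real^3^3 \<Rightarrow> vec3 \<times> vec3 \<Rightarrow> vec3" where
  "Omega m r \<I> = (\<lambda>(\<gamma>, K). THE w. K = \<I> *v w + (m * r\<^sup>2 * (w \<bullet> \<gamma>)) *\<^sub>R \<gamma>)"

definition grad_gamma :: "(vec3 \<times> vec3 \<Rightarrow> real) \<Rightarrow> vec3 \<times> vec3 \<Rightarrow> vec3" where
  "grad_gamma F p = (\<chi> i. frechet_derivative F (at p) (axis i 1, 0))"

definition grad_K :: "(vec3 \<times> vec3 \<Rightarrow> real) \<Rightarrow> vec3 \<times> vec3 \<Rightarrow> vec3" where
  "grad_K F p = (\<chi> i. frechet_derivative F (at p) (0, axis i 1))"

definition rank1_formula ::
    "real \<Rightarrow> real \<Rightarrow> real^3^3 \<Rightarrow> (vec3 \<times> vec3 \<Rightarrow> real) \<Rightarrow> (vec3 \<times> vec3 \<Rightarrow> real) \<Rightarrow> vec3 \<times> vec3 \<Rightarrow> real" where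
  "rank1_formula m r \<I> F G = (\<lambda>(\<gamma>, K).
     - (K + (m * r\<^sup>2 * (Omega m r \<I> (\<gamma>, K) \<bullet> \<gamma>)) *\<^sub>R \<gamma>) \<bullet> (grad_K F (\<gamma>, K) \<times> grad_K G (\<gamma>, K))
     - \<gamma> \<bullet> (grad_K F (\<gamma>, K) \<times> grad_gamma G (\<gamma>, K) - grad_K G (\<gamma>, K) \<times> grad_gamma F (\<gamma>, K)))"

text \<open>The formula is in the redundant coordinates of the ambient space; a function on the reduced
  space is first extended smoothly near the point. The value does not depend on the extension because
  \<open>\<gamma> \<bullet> \<gamma>\<close> is a Casimir function of the formula.\<close>

definition rank1_bracket ::
    "real \<Rightarrow> real \<Rightarrow> real^3^3 \<Rightarrow> (vec3 \<times> vec3 \<Rightarrow> real) \<Rightarrow> (vec3 \<times> vec3 \<Rightarrow> real) \<Rightarrow> vec3 \<times> vec3 \<Rightarrow> real" where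
  "rank1_bracket m r \<I> f g p =
     rank1_formula m r \<I> (SOME F. local_extension reduced_space p f F)
                         (SOME G. local_extension reduced_space p g G) p"

definition area_form :: "vec3 \<times> vec3 \<Rightarrow> vec3 \<times> vec3 \<Rightarrow> vec3 \<times> vec3 \<Rightarrow> real" where
  "area_form p u v = fst p \<bullet> (fst u \<times> fst v)"

definition B_form ::
    "real \<Rightarrow> real \<Rightarrow> real^3^3 \<Rightarrow> vec3 \<times> vec3 \<Rightarrow> vec3 \<times> vec3 \<Rightarrow> vec3 \<times> vec3 \<Rightarrow> real" where
  "B_form m r \<I> p u v = m * r\<^sup>2 * (Omega m r \<I> p \<bullet> fst p) * area_form p u v"

end

theory Submission
  imports Defs
begin

text \<open>
  Covectors are represented by ambient vectors \<open>a = (a\<^sub>1, a\<^sub>2)\<close>. With \<open>c = m * r\<^sup>2 * (\<Omega> \<bullet> \<gamma>)\<close> the bracket is given by the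
  linear maps \<open>\<Pi> a = (a\<^sub>2 \<times> \<gamma>, a\<^sub>1 \<times> \<gamma> + a\<^sub>2 \<times> (K + c \<gamma>))\<close>. For sections \<open>X = \<Pi> a\<close>, \<open>Y = \<Pi> b\<close> of the graph all derivatives of
  \<open>a\<close> and \<open>b\<close> drop out of the condition that the Courant bracket is again a section, because \<open>\<Pi>\<close> is
  skew. What remains is an identity linear in \<open>dc\<close>: the terms without \<open>dc\<close> cancel by the Jacobi identity of
  the cross product, and the terms with \<open>dc\<close> are compensated by \<open>\<phi> = dc \<and> \<sigma>\<close>, since \<open>\<sigma>(X, Y) = \<gamma> \<bullet> (a\<^sub>2 \<times> b\<^sub>2)\<close>.
  Derivatives of functions on the reduced space are taken within it; they are determined on tangent
  vectors, so that no choice of local extensions matters.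
\<close>

section \<open>Smooth functions on open sets\<close>

text \<open>The Lie derivative contributes \<open>b \<bullet> \<Pi>(D_w a)\<close>, which skewness
  turns into \<open>- Y \<bullet> D_w a\<close>; the term \<open>- d\<alpha>(Y, w)\<close>
  contributes \<open>Y \<bullet> D_w a\<close>. Only derivatives of the coefficients of
  \<open>\<Pi>\<close> survive. There each term of the twist has its task: \<open>dc(X)\<close> and
  \<open>dc(Y)\<close> supply the part of the new covector that \<open>[X, Y]\<close> requires,
  while \<open>dc(w)\<close> cancels a term that the Lie derivative leaves behind. The identity
  \<open>d(c \<sigma>) = dc \<and> \<sigma>\<close> holds because \<open>\<sigma>\<close> lives on a
  surface, so \<open>d\<sigma> = 0\<close>. Closedness then rests on the symmetry of the second
  derivatives of \<open>c\<close>, read off from an explicit Hessian on the ambient space. Two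
  features of the definitions shape the work. Covectors are extended by 0 off the tangent space and
  hence are not linear on the ambient space, so they are composed with the orthogonal projection
  before being represented by vectors. Forms are evaluated on fields picked by a choice operator, so
  each formula must first be freed from the derivatives of these fields.\<close>

lemma Ck_on_has_derivative:
  assumes "Ck_on (Suc k) U F" "x \<in> U"
  shows "(F has_derivative frechet_derivative F (at x)) (at x)"
  using assms by (simp add: frechet_derivative_works)

lemma Ck_on_cong:
  assumes "open U"
  shows "(\<And>x. x \<in> U \<Longrightarrow> F x = G x) \<Longrightarrow> Ck_on k U F \<Longrightarrow> Ck_on k U G"
proof (induction k arbitrary: F G)
  case 0
  then show ?case
    by (simp cong: continuous_on_cong)
next
  case (Suc k)
  have der: "(G has_derivative frechet_derivative F (at x)) (at x)" if "x \<in> U" for x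
    using has_derivative_transform_within_open[OF Ck_on_has_derivative[OF Suc.prems(2)] assms] Suc.prems(1) that
    by blast
  have "Ck_on k U (\<lambda>x. frechet_derivative G (at x) v)" for v
  proof (rule Suc.IH)
    show "Ck_on k U (\<lambda>x. frechet_derivative F (at x) v)"
      using Suc.prems(2) by simp
    show "frechet_derivative F (at x) v = frechet_derivative G (at x) v" if "x \<in> U" for x
      using frechet_derivative_at[OF der[OF that]] by simp
  qed
  with der show ?case
    by (auto simp: differentiable_def)
qed

text \<open>At a point of an open set the derivative is unique, so an explicit formula may replace
  the one chosen by \<open>frechet_derivative\<close> in the recursion.\<close>

lemma Ck_on_SucI:
  assumes "open U" and der: "\<And>x. x \<in> U \<Longrightarrow> (F has_derivative F' x) (at x)"
    and Ck: "\<And>v. Ck_on k U (\<lambda>x. F' x v)"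
  shows "Ck_on (Suc k) U F"
proof -
  have "F' x v = frechet_derivative F (at x) v" if "x \<in> U" for x v
    using frechet_derivative_at[OF der[OF that]] by simp
  then have "Ck_on k U (\<lambda>x. frechet_derivative F (at x) v)" for v
    by (rule Ck_on_cong[OF assms(1) _ Ck])
  with der show ?thesis
    by (auto simp: differentiable_def)
qed

lemma Ck_on_subset: "Ck_on k U F \<Longrightarrow> V \<subseteq> U \<Longrightarrow> Ck_on k V F"
  by (induction k arbitrary: F) (auto intro: continuous_on_subset)

lemma Ck_on_SucD: "Ck_on (Suc k) U F \<Longrightarrow> Ck_on k U F"
proof (induction k arbitrary: F)
  case 0
  then show ?case
    by (simp add: differentiable_imp_continuous_on differentiable_on_def differentiable_at_withinI)
next
  case (Suc k)
  then show ?case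
    by (metis Ck_on.simps(2))
qed

lemma Ck_on_const: "open U \<Longrightarrow> Ck_on k U (\<lambda>x. c)"
proof (induction k arbitrary: c)
  case (Suc k)
  show ?case
    by (rule Ck_on_SucI[where F' = "\<lambda>x v. 0"]) (use Suc in auto)
qed simp

lemma Ck_on_ident: "open U \<Longrightarrow> Ck_on k U (\<lambda>x. x)"
proof (cases k)
  case (Suc n)
  assume "open U"
  then show ?thesis
    unfolding Suc by (intro Ck_on_SucI[where F' = "\<lambda>x v. v"] Ck_on_const) auto
qed simp

lemma Ck_on_bounded_linear:
  assumes "bounded_linear h" "open U"
  shows "Ck_on k U F \<Longrightarrow> Ck_on k U (\<lambda>x. h (F x))"
proof (induction k arbitrary: F)
  case 0
  then show ?case
    using bounded_linear.continuous_on[OF assms(1)] by simp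
next
  case (Suc k)
  show ?case
    by (rule Ck_on_SucI[where F' = "\<lambda>x v. h (frechet_derivative F (at x) v)"])
      (use Suc assms in \<open>auto intro!: bounded_linear.has_derivative[OF assms(1)]
         Ck_on_has_derivative[OF Suc.prems]\<close>)
qed

lemma Ck_on_add:
  assumes "open U"
  shows "Ck_on k U F \<Longrightarrow> Ck_on k U G \<Longrightarrow> Ck_on k U (\<lambda>x. F x + G x)"
proof (induction k arbitrary: F G)
  case 0
  then show ?case by (auto intro: continuous_on_add)
next
  case (Suc k)
  show ?case
    by (rule Ck_on_SucI[where F' = "\<lambda>x v. frechet_derivative F (at x) v + frechet_derivative G (at x) v"])
      (use Suc assms in \<open>auto intro!: has_derivative_add Ck_on_has_derivative[OF Suc.prems(1)]
         Ck_on_has_derivative[OF Suc.prems(2)]\<close>)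
qed

text \<open>Each summand of the product rule pairs one derivative with one undifferentiated factor.
  The induction therefore ranges over all \<open>F\<close> and \<open>G\<close> and also needs both
  factors at the lower order.\<close>

lemma Ck_on_bilinear:
  assumes "bounded_bilinear h" "open U"
  shows "Ck_on k U F \<Longrightarrow> Ck_on k U G \<Longrightarrow> Ck_on k U (\<lambda>x. h (F x) (G x))"
proof (induction k arbitrary: F G)
  case 0
  then show ?case
    using bounded_bilinear.continuous_on[OF assms(1)] by auto
next
  case (Suc k)
  show ?case
  proof (rule Ck_on_SucI[OF assms(2)])
    fix x assume "x \<in> U"
    then show "((\<lambda>x. h (F x) (G x)) has_derivative
        (\<lambda>v. h (F x) (frechet_derivative G (at x) v) + h (frechet_derivative F (at x) v) (G x))) (at x)"
      by (intro bounded_bilinear.FDERIV[OF assms(1)] Ck_on_has_derivative[OF Suc.prems(1)]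
          Ck_on_has_derivative[OF Suc.prems(2)])
  next
    fix v
    show "Ck_on k U (\<lambda>x. h (F x) (frechet_derivative G (at x) v) + h (frechet_derivative F (at x) v) (G x))"
      using Suc.prems
      by (intro Ck_on_add[OF assms(2)] Suc.IH Ck_on_SucD[OF Suc.prems(1)] Ck_on_SucD[OF Suc.prems(2)]) auto
  qed
qed

text \<open>The derivative of the reciprocal is a product of the derivative of \<open>F\<close> with
  two copies of the reciprocal itself, so order \<open>k\<close> for the same \<open>F\<close> gives
  order \<open>k + 1\<close>.\<close>

lemma Ck_on_inverse:
  fixes F :: "'a::euclidean_space \<Rightarrow> real"
  assumes "open U" and nz: "\<And>x. x \<in> U \<Longrightarrow> F x \<noteq> 0"
  shows "Ck_on k U F \<Longrightarrow> Ck_on k U (\<lambda>x. inverse (F x))"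
proof (induction k)
  case 0
  then show ?case
    using nz by (auto intro: continuous_on_inverse)
next
  case (Suc k)
  note inv = Suc.IH[OF Ck_on_SucD[OF Suc.prems]]
  show ?case
  proof (rule Ck_on_SucI[OF assms(1)])
    fix x assume "x \<in> U"
    then show "((\<lambda>x. inverse (F x)) has_derivative
        (\<lambda>v. - (inverse (F x) * frechet_derivative F (at x) v * inverse (F x)))) (at x)"
      by (intro Deriv.has_derivative_inverse Ck_on_has_derivative[OF Suc.prems] nz)
  next
    fix v
    show "Ck_on k U (\<lambda>x. - (inverse (F x) * frechet_derivative F (at x) v * inverse (F x)))"
      using Suc.prems
      by (intro Ck_on_bounded_linear[OF bounded_linear_minus[OF bounded_linear_ident]]
          Ck_on_bilinear[OF bounded_bilinear_mult] assms(1) inv) auto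
  qed
qed

lemma Ck_on_sum:
  assumes "open U" "\<And>i. i \<in> I \<Longrightarrow> Ck_on k U (F i)"
  shows "Ck_on k U (\<lambda>x. \<Sum>i\<in>I. F i x)"
  using assms(2)
proof (induction I rule: infinite_finite_induct)
  case (insert i I)
  then show ?case by (auto intro: Ck_on_add[OF assms(1)])
qed (auto simp: Ck_on_const[OF assms(1)])

section \<open>Functions of class C-infinity\<close>

lemma Cinf_on_differentiable: "Cinf_on U F \<Longrightarrow> x \<in> U \<Longrightarrow> F differentiable (at x)"
  unfolding Cinf_on_def by (metis Ck_on.simps(2))

lemma Cinf_on_frechet_derivative:
  "Cinf_on U F \<Longrightarrow> Cinf_on U (\<lambda>x. frechet_derivative F (at x) v)"
  unfolding Cinf_on_def by (metis Ck_on.simps(2))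

lemma Cinf_on_subset: "Cinf_on U F \<Longrightarrow> V \<subseteq> U \<Longrightarrow> Cinf_on V F"
  unfolding Cinf_on_def by (blast intro: Ck_on_subset)

lemma Cinf_on_continuous_on: "Cinf_on U F \<Longrightarrow> continuous_on U F"
  unfolding Cinf_on_def by (metis Ck_on.simps(1))

lemma Cinf_on_cong: "open U \<Longrightarrow> (\<And>x. x \<in> U \<Longrightarrow> F x = G x) \<Longrightarrow> Cinf_on U F \<Longrightarrow> Cinf_on U G"
  unfolding Cinf_on_def using Ck_on_cong by blast

lemma Cinf_on_bounded_linear:
  "bounded_linear h \<Longrightarrow> open U \<Longrightarrow> Cinf_on U F \<Longrightarrow> Cinf_on U (\<lambda>x. h (F x))"
  unfolding Cinf_on_def by (blast intro: Ck_on_bounded_linear)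

lemma Cinf_on_bilinear:
  "bounded_bilinear h \<Longrightarrow> open U \<Longrightarrow> Cinf_on U F \<Longrightarrow> Cinf_on U G \<Longrightarrow> Cinf_on U (\<lambda>x. h (F x) (G x))"
  unfolding Cinf_on_def by (blast intro: Ck_on_bilinear)

lemma Cinf_on_add: "open U \<Longrightarrow> Cinf_on U F \<Longrightarrow> Cinf_on U G \<Longrightarrow> Cinf_on U (\<lambda>x. F x + G x)"
  unfolding Cinf_on_def by (blast intro: Ck_on_add)

lemma Cinf_on_inverse:
  fixes F :: "'a::euclidean_space \<Rightarrow> real"
  shows "open U \<Longrightarrow> (\<And>x. x \<in> U \<Longrightarrow> F x \<noteq> 0) \<Longrightarrow> Cinf_on U F \<Longrightarrow> Cinf_on U (\<lambda>x. inverse (F x))"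
  unfolding Cinf_on_def by (blast intro: Ck_on_inverse)

lemma Cinf_on_const: "open U \<Longrightarrow> Cinf_on U (\<lambda>x. c)"
  unfolding Cinf_on_def by (blast intro: Ck_on_const)

lemma Cinf_on_ident: "open U \<Longrightarrow> Cinf_on U (\<lambda>x. x)"
  unfolding Cinf_on_def by (blast intro: Ck_on_ident)

lemma Cinf_on_derivative_along:
  assumes "open U" and F: "Cinf_on U F" and X: "Cinf_on U X"
  shows "Cinf_on U (\<lambda>x. frechet_derivative F (at x) (X x))"
proof (rule Cinf_on_cong[OF assms(1)])
  \<comment> \<open>\<open>Ck_on\<close> speaks of constant directions only, so the moving direction
    \<open>X x\<close> is expanded in the ambient basis.\<close>
  show "Cinf_on U (\<lambda>x. \<Sum>b\<in>Basis. (X x \<bullet> b) *\<^sub>R frechet_derivative F (at x) b)"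
    using X Cinf_on_frechet_derivative[OF F] unfolding Cinf_on_def
    by (intro allI Ck_on_sum Ck_on_bilinear[OF bounded_bilinear_scaleR]
        Ck_on_bounded_linear[OF bounded_linear_inner_left] assms(1)) auto
  fix x assume "x \<in> U"
  then have lin: "linear (frechet_derivative F (at x))"
    using linear_frechet_derivative[OF Cinf_on_differentiable[OF F]] by simp
  show "(\<Sum>b\<in>Basis. (X x \<bullet> b) *\<^sub>R frechet_derivative F (at x) b) = frechet_derivative F (at x) (X x)"
    by (subst (2) euclidean_representation[of "X x", symmetric])
      (simp add: linear_sum[OF lin] linear_cmul[OF lin])
qed

section \<open>Smooth maps on a subset of a Euclidean space\<close>

lemma local_extensionI:
  "open U \<Longrightarrow> p \<in> U \<Longrightarrow> Cinf_on U F \<Longrightarrow> (\<And>q. q \<in> M \<Longrightarrow> q \<in> U \<Longrightarrow> F q = f q) \<Longrightarrow> local_extension M p f F"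
  unfolding local_extension_def by blast

lemma local_extensionE:
  assumes "smooth_map M f" "p \<in> M"
  obtains U F where "open U" "p \<in> U" "Cinf_on U F" "\<And>q. q \<in> M \<Longrightarrow> q \<in> U \<Longrightarrow> F q = f q"
proof -
  obtain F where "local_extension M p f F"
    using assms unfolding smooth_map_def by blast
  then obtain U where U: "open U" "p \<in> U" "Cinf_on U F" "\<forall>q\<in>M \<inter> U. F q = f q"
    unfolding local_extension_def by auto
  show thesis
    by (rule that[OF U(1-3)]) (simp add: U(4))
qed

lemma smooth_mapI:
  assumes "\<And>p. p \<in> M \<Longrightarrow> \<exists>U F. open U \<and> p \<in> U \<and> Cinf_on U F \<and> (\<forall>q\<in>M \<inter> U. F q = f q)"
  shows "smooth_map M f"
  using assms unfolding smooth_map_def local_extension_def by blast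

lemma smooth_map_cong: "smooth_map M f \<Longrightarrow> (\<And>p. p \<in> M \<Longrightarrow> f p = g p) \<Longrightarrow> smooth_map M g"
  unfolding smooth_map_def local_extension_def by simp

lemma smooth_map_Cinf: "Cinf_on UNIV f \<Longrightarrow> smooth_map M f"
  by (rule smooth_mapI) (auto intro!: exI[of _ UNIV] exI[of _ f])

lemma smooth_map_const: "smooth_map M (\<lambda>p. c)"
  by (intro smooth_map_Cinf Cinf_on_const) simp

lemma smooth_map_ident: "smooth_map M (\<lambda>p. p)"
  by (intro smooth_map_Cinf Cinf_on_ident) simp

lemma smooth_map_bounded_linear:
  assumes h: "bounded_linear h" and f: "smooth_map M f"
  shows "smooth_map M (\<lambda>p. h (f p))"
proof (rule smooth_mapI)
  fix p assume "p \<in> M"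
  then obtain U F where "open U" "p \<in> U" "Cinf_on U F" "\<And>q. q \<in> M \<Longrightarrow> q \<in> U \<Longrightarrow> F q = f q"
    using local_extensionE[OF f] by blast
  then show "\<exists>U F. open U \<and> p \<in> U \<and> Cinf_on U F \<and> (\<forall>q\<in>M \<inter> U. F q = h (f q))"
    by (intro exI[of _ U] exI[of _ "\<lambda>q. h (F q)"]) (auto intro: Cinf_on_bounded_linear[OF h])
qed

lemma smooth_map_combine:
  fixes M :: "'a::euclidean_space set"
  assumes f: "smooth_map M f" and g: "smooth_map M g"
    and C: "\<And>(U :: 'a set) F G. open U \<Longrightarrow> Cinf_on U F \<Longrightarrow> Cinf_on U G \<Longrightarrow> Cinf_on U (\<lambda>x. h (F x) (G x))"
  shows "smooth_map M (\<lambda>p. h (f p) (g p))"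
proof (rule smooth_mapI)
  fix p assume p: "p \<in> M"
  obtain U F where U: "open U" "p \<in> U" "Cinf_on U F" "\<And>q. q \<in> M \<Longrightarrow> q \<in> U \<Longrightarrow> F q = f q"
    using local_extensionE[OF f p] by blast
  obtain V G where V: "open V" "p \<in> V" "Cinf_on V G" "\<And>q. q \<in> M \<Longrightarrow> q \<in> V \<Longrightarrow> G q = g q"
    using local_extensionE[OF g p] by blast
  show "\<exists>U F. open U \<and> p \<in> U \<and> Cinf_on U F \<and> (\<forall>q\<in>M \<inter> U. F q = h (f q) (g q))"
    using U V by (intro exI[of _ "U \<inter> V"] exI[of _ "\<lambda>q. h (F q) (G q)"])
      (auto intro!: C intro: Cinf_on_subset[OF U(3)] Cinf_on_subset[OF V(3)])
qed

lemma smooth_map_bilinear: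
  assumes "bounded_bilinear h" "smooth_map M f" "smooth_map M g"
  shows "smooth_map M (\<lambda>p. h (f p) (g p))"
  by (rule smooth_map_combine[of M f g h, OF assms(2,3)]) (rule Cinf_on_bilinear[OF assms(1)])

lemma smooth_map_add: "smooth_map M f \<Longrightarrow> smooth_map M g \<Longrightarrow> smooth_map M (\<lambda>p. f p + g p)"
  by (rule smooth_map_combine[of M f g "(+)"]) (simp_all add: Cinf_on_add)

lemmas smooth_map_scaleR = smooth_map_bilinear[OF bounded_bilinear_scaleR]
lemmas smooth_map_mult = smooth_map_bilinear[OF bounded_bilinear_mult]
lemmas smooth_map_inner = smooth_map_bilinear[OF bounded_bilinear_inner]
lemmas smooth_map_fst = smooth_map_bounded_linear[OF bounded_linear_fst]
lemmas smooth_map_snd = smooth_map_bounded_linear[OF bounded_linear_snd]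
lemmas smooth_map_minus = smooth_map_bounded_linear[OF bounded_linear_minus[OF bounded_linear_ident]]

lemma smooth_map_diff: "smooth_map M f \<Longrightarrow> smooth_map M g \<Longrightarrow> smooth_map M (\<lambda>p. f p - g p)"
  using smooth_map_add[of M f "\<lambda>p. - g p"] smooth_map_minus by auto

lemma smooth_map_Pair:
  assumes "smooth_map M f" "smooth_map M g"
  shows "smooth_map M (\<lambda>p. (f p, g p))"
proof -
  have "smooth_map M (\<lambda>p. (f p, 0) + (0, g p))"
    by (rule smooth_map_add[OF smooth_map_bounded_linear[OF _ assms(1), of "\<lambda>v. (v, 0)"]
        smooth_map_bounded_linear[OF _ assms(2), of "\<lambda>v. (0, v)"]])
      (auto intro!: bounded_linear_Pair bounded_linear_ident bounded_linear_zero)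
  then show ?thesis by simp
qed

lemma smooth_map_sum: "(\<And>i. i \<in> I \<Longrightarrow> smooth_map M (f i)) \<Longrightarrow> smooth_map M (\<lambda>p. \<Sum>i\<in>I. f i p)"
  by (induction I rule: infinite_finite_induct) (auto intro: smooth_map_add smooth_map_const)

lemma smooth_map_inverse:
  fixes f :: "'a::euclidean_space \<Rightarrow> real"
  assumes f: "smooth_map M f" and nz: "\<And>p. p \<in> M \<Longrightarrow> f p \<noteq> 0"
  shows "smooth_map M (\<lambda>p. inverse (f p))"
proof (rule smooth_mapI)
  fix p assume p: "p \<in> M"
  obtain U F where U: "open U" "p \<in> U" "Cinf_on U F" "\<And>q. q \<in> M \<Longrightarrow> q \<in> U \<Longrightarrow> F q = f q"
    using local_extensionE[OF f p] by blast
  \<comment> \<open>The local extension may vanish away from \<open>M\<close>; the neighbourhood is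
    shrunk to avoid its zeros.\<close>
  define V where "V = U \<inter> F -` (- {0})"
  have "open V"
    unfolding V_def using U by (intro continuous_open_preimage Cinf_on_continuous_on) auto
  then show "\<exists>U F. open U \<and> p \<in> U \<and> Cinf_on U F \<and> (\<forall>q\<in>M \<inter> U. F q = inverse (f q))"
    using U p nz[OF p] by (intro exI[of _ V] exI[of _ "\<lambda>q. inverse (F q)"])
      (auto simp: V_def intro!: Cinf_on_inverse intro: Cinf_on_subset[OF U(3)])
qed

section \<open>Derivatives within a subset and along its tangent vectors\<close>

lemma smooth_map_has_derivative:
  assumes "smooth_map M f" "p \<in> M"
  shows "(f has_derivative frechet_derivative f (at p within M)) (at p within M)"
proof -
  obtain U F where U: "open U" "p \<in> U" "Cinf_on U F" "\<And>q. q \<in> M \<Longrightarrow> q \<in> U \<Longrightarrow> F q = f q"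
    using local_extensionE[OF assms] by blast
  have "(F has_derivative frechet_derivative F (at p)) (at p within M)"
    using Cinf_on_differentiable[OF U(3,2)] has_derivative_at_withinI frechet_derivative_works by blast
  then have "(f has_derivative frechet_derivative F (at p)) (at p within M)"
    by (rule has_derivative_transform_eventually)
      (use U assms in \<open>auto simp: eventually_at_filter intro!: eventually_mono[OF eventually_nhds_in_open[OF U(1,2)]]\<close>)
  then show ?thesis
    using frechet_derivative_works differentiable_def by blast
qed

text \<open>Derivatives within a thin set such as a submanifold are not unique as linear maps.
  Composed with a curve in \<open>M\<close> of velocity \<open>v\<close> they become ordinary
  derivatives in one real variable, and these are unique.\<close>

lemma has_derivative_unique_tangent:
  assumes "(f has_derivative D) (at p within M)" "(f has_derivative D') (at p within M)"
    and "v \<in> tangent_space M p"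
  shows "D v = D' v"
proof -
  obtain c where c: "range c \<subseteq> M" "c 0 = p" "(c has_vector_derivative v) (at 0)"
    using assms(3) unfolding tangent_space_def by blast
  have "((\<lambda>t. f (c t)) has_vector_derivative E v) (at 0)" if "(f has_derivative E) (at p within M)" for E
  proof -
    have "(f has_derivative E) (at (c 0) within range c)"
      using has_derivative_subset[OF that c(1)] c(2) by simp
    then have "((f \<circ> c) has_derivative E \<circ> (\<lambda>t. t *\<^sub>R v)) (at 0 within UNIV)"
      using c(3) unfolding has_vector_derivative_def by (intro diff_chain_within) auto
    moreover have "linear E"
      using that has_derivative_linear by blast
    ultimately show ?thesis
      unfolding has_vector_derivative_def by (simp add: o_def linear_cmul)
  qed
  from this[OF assms(1)] this[OF assms(2)] show ?thesis
    by (rule vector_derivative_unique_at)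
qed

lemma frechet_derivative_within_eq:
  assumes "(f has_derivative D) (at p within M)" "v \<in> tangent_space M p"
  shows "frechet_derivative f (at p within M) v = D v"
  using assms has_derivative_unique_tangent differentiable_def frechet_derivative_works by blast

lemma deriv_along_eq:
  assumes "(f has_derivative D) (at p within M)" "X p \<in> tangent_space M p"
  shows "deriv_along M X f p = D (X p)"
  using frechet_derivative_within_eq[OF assms] by (simp add: deriv_along_def)

lemma deriv_along_cong:
  assumes "\<And>q. q \<in> M \<Longrightarrow> f q = g q" "p \<in> M"
  shows "deriv_along M X f p = deriv_along M X g p"
proof -
  \<comment> \<open>Both functions have the same derivatives within \<open>M\<close>, so the choice
    operator in \<open>frechet_derivative\<close> receives the same predicate.\<close>
  have "(f has_derivative D) (at p within M) = (g has_derivative D) (at p within M)" for D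
    using assms has_derivative_transform[of p M f g D] has_derivative_transform[of p M g f D] by metis
  then show ?thesis
    by (simp add: deriv_along_def frechet_derivative_def)
qed

text \<open>An ambient derivative of an extension is also a derivative of \<open>f\<close> within
  \<open>M\<close>, and these agree on tangent vectors. This makes the bracket independent of the
  extensions it picks.\<close>

lemma local_extension_frechet_derivative:
  assumes "local_extension M p f F" "p \<in> M" "v \<in> tangent_space M p"
  shows "F differentiable (at p)" and "frechet_derivative F (at p) v = frechet_derivative f (at p within M) v"
proof -
  obtain U where U: "open U" "p \<in> U" "Cinf_on U F" "\<And>q. q \<in> M \<Longrightarrow> q \<in> U \<Longrightarrow> F q = f q"
    using assms unfolding local_extension_def by blast
  show diff: "F differentiable (at p)"
    using Cinf_on_differentiable[OF U(3,2)] .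
  have "(F has_derivative frechet_derivative F (at p)) (at p within M)"
    using diff has_derivative_at_withinI frechet_derivative_works by blast
  then have "(f has_derivative frechet_derivative F (at p)) (at p within M)"
    by (rule has_derivative_transform_eventually)
      (use U assms in \<open>auto simp: eventually_at_filter intro!: eventually_mono[OF eventually_nhds_in_open[OF U(1,2)]]\<close>)
  from frechet_derivative_within_eq[OF this assms(3)]
  show "frechet_derivative F (at p) v = frechet_derivative f (at p within M) v" by simp
qed

lemma smooth_map_deriv_along:
  assumes f: "smooth_map M f" and X: "X \<in> vector_fields M"
  shows "smooth_map M (deriv_along M X f)"
proof (rule smooth_mapI)
  fix p assume p: "p \<in> M"
  obtain U F where U: "open U" "p \<in> U" "Cinf_on U F" "\<And>q. q \<in> M \<Longrightarrow> q \<in> U \<Longrightarrow> F q = f q"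
    using local_extensionE[OF f p] by blast
  obtain V Y where V: "open V" "p \<in> V" "Cinf_on V Y" "\<And>q. q \<in> M \<Longrightarrow> q \<in> V \<Longrightarrow> Y q = X q"
    using X p local_extensionE[of M X p] unfolding vector_fields_def by blast
  have "frechet_derivative F (at q) (Y q) = deriv_along M X f q" if "q \<in> M" "q \<in> U" "q \<in> V" for q
  proof -
    have "local_extension M q f F"
      using U that by (intro local_extensionI)
    moreover have "X q \<in> tangent_space M q"
      using X that unfolding vector_fields_def by blast
    ultimately show ?thesis
      using local_extension_frechet_derivative(2) V(4) that unfolding deriv_along_def by metis
  qed
  then show "\<exists>U F. open U \<and> p \<in> U \<and> Cinf_on U F \<and> (\<forall>q\<in>M \<inter> U. F q = deriv_along M X f q)"
    using U V by (intro exI[of _ "U \<inter> V"] exI[of _ "\<lambda>q. frechet_derivative F (at q) (Y q)"])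
      (auto intro!: Cinf_on_derivative_along intro: Cinf_on_subset[OF U(3)] Cinf_on_subset[OF V(3)])
qed

section \<open>The cross product and the geometry of the reduced space\<close>

lemma bounded_bilinear_cross: "bounded_bilinear (\<times>)"
  using bilinear_cross bilinear_conv_bounded_bilinear by blast

lemmas smooth_map_cross = smooth_map_bilinear[OF bounded_bilinear_cross]
lemmas has_derivative_cross = bounded_bilinear.FDERIV[OF bounded_bilinear_cross]

lemma reduced_space_iff: "p \<in> reduced_space \<longleftrightarrow> fst p \<bullet> fst p = 1"
  by (auto simp: reduced_space_def norm_eq_1 split: prod.splits)

lemma tangent_space_reduced_space:
  assumes p: "p \<in> reduced_space"
  shows "tangent_space reduced_space p = {v. fst v \<bullet> fst p = 0}"
proof (intro equalityI subsetI)
  fix v assume "v \<in> tangent_space reduced_space p"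
  then obtain c where c: "range c \<subseteq> reduced_space" "c 0 = p" "(c has_vector_derivative v) (at 0)"
    unfolding tangent_space_def by blast
  have "((\<lambda>t. fst (c t)) has_derivative (\<lambda>t. fst (t *\<^sub>R v))) (at 0)"
    using c(3) unfolding has_vector_derivative_def by (rule has_derivative_fst)
  from has_derivative_inner[OF this this]
  have "((\<lambda>t. fst (c t) \<bullet> fst (c t)) has_derivative
      (\<lambda>t. fst (c 0) \<bullet> fst (t *\<^sub>R v) + fst (t *\<^sub>R v) \<bullet> fst (c 0))) (at 0)" .
  moreover have "fst (c t) \<bullet> fst (c t) = 1" for t
    using c(1) reduced_space_iff by blast
  ultimately have "((\<lambda>t::real. 1) has_derivative
      (\<lambda>t. fst (c 0) \<bullet> fst (t *\<^sub>R v) + fst (t *\<^sub>R v) \<bullet> fst (c 0))) (at 0)"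
    by simp
  then have "(\<lambda>t. fst (c 0) \<bullet> fst (t *\<^sub>R v) + fst (t *\<^sub>R v) \<bullet> fst (c 0)) = (\<lambda>t::real. 0)"
    by (rule has_derivative_unique[OF _ has_derivative_const])
  from fun_cong[OF this, of 1] show "v \<in> {v. fst v \<bullet> fst p = 0}"
    using c(2) by (simp add: inner_commute)
next
  fix v :: "vec3 \<times> vec3" assume "v \<in> {v. fst v \<bullet> fst p = 0}"
  then have orth: "fst v \<bullet> fst p = 0" "fst p \<bullet> fst v = 0"
    by (simp_all add: inner_commute)
  define a where "a = fst v \<bullet> fst v"
  have pos: "4 + a * (t * t) > 0" for t
    by (simp add: a_def add_pos_nonneg)
  \<comment> \<open>This is the half-angle substitution with parameter \<open>s = |u| t / 2\<close>,
    where \<open>u = fst v\<close> and \<open>a = |u|^2\<close>. Clearing fractions produces the 4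
    and avoids the norm of \<open>u\<close>; the velocity at 0 is then \<open>v\<close>
    itself.\<close>
  define d where "d t = inverse (4 + a * (t * t))" for t
  \<comment> \<open>the rational parametrisation of the great circle through \<open>fst p\<close> in direction \<open>fst v\<close>\<close>
  define c where "c t = (8 * d t + - 1) *\<^sub>R (fst p, 0) + (4 * t * d t) *\<^sub>R (fst v, 0)
      + ((0, snd p) + t *\<^sub>R (0, snd v))" for t
  have smooth_d: "Cinf_on UNIV d"
    unfolding d_def using pos
    by (intro Cinf_on_inverse Cinf_on_add Cinf_on_bilinear[OF bounded_bilinear_mult] Cinf_on_const
        Cinf_on_ident open_UNIV) (metis less_irrefl)
  have "Cinf_on UNIV c"
    unfolding c_def
    by (intro Cinf_on_add Cinf_on_bilinear[OF bounded_bilinear_scaleR]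
        Cinf_on_bilinear[OF bounded_bilinear_mult] Cinf_on_const Cinf_on_ident open_UNIV smooth_d)
  moreover have "c t \<in> reduced_space" for t
  proof -
    have "fst (c t) \<bullet> fst (c t) = (8 * d t - 1)\<^sup>2 + (4 * t * d t)\<^sup>2 * a"
      using p orth by (simp add: c_def reduced_space_iff inner_add_left inner_add_right a_def power2_eq_square)
    also have "\<dots> = 1 + 16 * d t * (d t * (4 + a * (t * t)) - 1)"
      by (simp add: power2_eq_square algebra_simps)
    also have "\<dots> = 1"
      using pos[of t] by (simp add: d_def)
    finally show ?thesis
      by (simp add: reduced_space_iff)
  qed
  moreover have "c 0 = p"
    by (simp add: c_def d_def prod_eq_iff)
  moreover have "(c has_vector_derivative v) (at 0)"
  proof -
    have "(d has_derivative (\<lambda>h. 0)) (at 0)"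
      unfolding d_def by (rule derivative_eq_intros refl | simp)+
    then have "(c has_derivative (\<lambda>h. h *\<^sub>R v)) (at 0)"
      unfolding c_def
      by (auto intro!: derivative_eq_intros simp: d_def fun_eq_iff prod_eq_iff)
    then show ?thesis
      by (simp add: has_vector_derivative_def)
  qed
  ultimately show "v \<in> tangent_space reduced_space p"
    unfolding tangent_space_def by blast
qed

text \<open>Two vectors orthogonal to the unit normal \<open>fst p\<close> have a cross product that
  is a multiple of this normal, and \<open>fst u\<close> is orthogonal to it.\<close>

lemma tangent_triple_product:
  assumes "p \<in> reduced_space" "u \<in> tangent_space reduced_space p"
    "v \<in> tangent_space reduced_space p" "w \<in> tangent_space reduced_space p"
  shows "fst u \<bullet> (fst v \<times> fst w) = 0"
proof -
  have o: "fst u \<bullet> fst p = 0" "fst v \<bullet> fst p = 0" "fst w \<bullet> fst p = 0" "fst p \<bullet> fst p = 1"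
    using assms tangent_space_reduced_space[OF assms(1)] reduced_space_iff by auto
  have "fst p \<times> (fst v \<times> fst w) = 0"
    using o by (simp add: Lagrange inner_commute)
  then have "fst p \<times> (fst p \<times> (fst v \<times> fst w)) = 0"
    by simp
  then have "(fst p \<bullet> (fst v \<times> fst w)) *\<^sub>R fst p = fst v \<times> fst w"
    using o(4) by (simp add: Lagrange[of "fst p" "fst p"])
  then show ?thesis
    using o(1) by (metis inner_scaleR_right mult_zero_right)
qed

text \<open>\<open>lie_bracket\<close> is built from ambient derivatives, which need not be tangent.
  Differentiating \<open>fst (W q) \<bullet> fst q = 0\<close> along \<open>V\<close> shows that the
  normal component of each is \<open>- fst (W p) \<bullet> fst (V p)\<close>; this is symmetric in
  the two fields and cancels in the difference.\<close>

lemma lie_bracket_vector_fields: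
  assumes X: "X \<in> vector_fields reduced_space" and Y: "Y \<in> vector_fields reduced_space"
  shows "lie_bracket reduced_space X Y \<in> vector_fields reduced_space"
proof -
  have sm: "smooth_map reduced_space X" "smooth_map reduced_space Y"
    using X Y unfolding vector_fields_def by auto
  have der: "fst (deriv_along reduced_space V W p) \<bullet> fst p + fst (W p) \<bullet> fst (V p) = 0"
    if V: "V \<in> vector_fields reduced_space" and W: "W \<in> vector_fields reduced_space"
      and p: "p \<in> reduced_space" for V W p
  proof -
    have tan: "V q \<in> tangent_space reduced_space q" "fst (W q) \<bullet> fst q = 0" if "q \<in> reduced_space" for q
      using V W that tangent_space_reduced_space[OF that] unfolding vector_fields_def by blast+
    have "smooth_map reduced_space W"
      using W unfolding vector_fields_def by blast
    from has_derivative_inner[OF has_derivative_fst[OF smooth_map_has_derivative[OF this p]]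
        has_derivative_fst[OF has_derivative_ident]]
    have "((\<lambda>q. fst (W q) \<bullet> fst q) has_derivative
       (\<lambda>h. fst (W p) \<bullet> fst h + fst (frechet_derivative W (at p within reduced_space) h) \<bullet> fst p))
       (at p within reduced_space)" .
    then have "((\<lambda>q. 0) has_derivative
       (\<lambda>h. fst (W p) \<bullet> fst h + fst (frechet_derivative W (at p within reduced_space) h) \<bullet> fst p))
       (at p within reduced_space)"
      by (rule has_derivative_transform[rotated 2]) (use p tan in auto)
    from has_derivative_unique_tangent[OF this has_derivative_const tan(1)[OF p]]
    show ?thesis
      by (simp add: deriv_along_def add.commute)
  qed
  have "lie_bracket reduced_space X Y p \<in> tangent_space reduced_space p" if p: "p \<in> reduced_space" for p
    using der[OF X Y p] der[OF Y X p] tangent_space_reduced_space[OF p]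
    by (simp add: lie_bracket_def inner_diff_left) (simp add: inner_commute)
  moreover have "smooth_map reduced_space (lie_bracket reduced_space X Y)"
    unfolding lie_bracket_def[abs_def]
    by (intro smooth_map_diff smooth_map_deriv_along X Y sm)
  ultimately show ?thesis
    unfolding vector_fields_def by blast
qed

section \<open>Representing covectors by ambient vectors\<close>

text \<open>On the reduced space this is the orthogonal projection onto the tangent space. It is
  polynomial in \<open>p\<close>, so for fixed \<open>v\<close> it also provides global smooth
  vector fields.\<close>

definition tangent_proj :: "vec3 \<times> vec3 \<Rightarrow> vec3 \<times> vec3 \<Rightarrow> vec3 \<times> vec3" where
  "tangent_proj p v = (fst v - (fst v \<bullet> fst p) *\<^sub>R fst p, snd v)"

text \<open>The gradient vector of the functional \<open>a\<close> composed with the projection. The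
  projection keeps the arguments of \<open>a\<close> where a covector is linear.\<close>

definition covec :: "vec3 \<times> vec3 \<Rightarrow> (vec3 \<times> vec3 \<Rightarrow> real) \<Rightarrow> vec3 \<times> vec3" where
  "covec p a = (\<Sum>b\<in>Basis. a (tangent_proj p b) *\<^sub>R b)"

lemma tangent_proj_tangent:
  "p \<in> reduced_space \<Longrightarrow> tangent_proj p v \<in> tangent_space reduced_space p"
  by (simp add: tangent_space_reduced_space reduced_space_iff tangent_proj_def inner_diff_left)

lemma tangent_proj_id:
  "p \<in> reduced_space \<Longrightarrow> v \<in> tangent_space reduced_space p \<Longrightarrow> tangent_proj p v = v"
  by (simp add: tangent_space_reduced_space tangent_proj_def)

lemma linear_tangent_proj: "linear (tangent_proj p)"
  by (rule linearI) (simp_all add: tangent_proj_def inner_add_left algebra_simps)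

lemma tangent_proj_vector_field: "(\<lambda>p. tangent_proj p v) \<in> vector_fields reduced_space"
  unfolding vector_fields_def
  by (auto simp: tangent_proj_tangent)
    (auto simp: tangent_proj_def intro!: smooth_map_Pair smooth_map_diff smooth_map_scaleR smooth_map_inner
      smooth_map_const smooth_map_fst smooth_map_ident)

text \<open>Projecting the constant field \<open>v\<close> gives a witness, so the choice in
  \<open>extend_vector\<close> is meaningful.\<close>

lemma extend_vector_reduced_space:
  assumes "p \<in> reduced_space" "v \<in> tangent_space reduced_space p"
  shows "extend_vector reduced_space p v \<in> vector_fields reduced_space"
    and "extend_vector reduced_space p v p = v"
proof -
  have "\<exists>X. X \<in> vector_fields reduced_space \<and> X p = v"
    using tangent_proj_vector_field[of v] tangent_proj_id[OF assms] by blast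
  from someI_ex[OF this] show "extend_vector reduced_space p v \<in> vector_fields reduced_space"
    "extend_vector reduced_space p v p = v"
    unfolding extend_vector_def by auto
qed

lemma tangent_space_add:
  "p \<in> reduced_space \<Longrightarrow> u \<in> tangent_space reduced_space p \<Longrightarrow> v \<in> tangent_space reduced_space p \<Longrightarrow>
    u + v \<in> tangent_space reduced_space p"
  by (simp add: tangent_space_reduced_space inner_add_left)

lemma tangent_space_scaleR:
  "p \<in> reduced_space \<Longrightarrow> u \<in> tangent_space reduced_space p \<Longrightarrow> t *\<^sub>R u \<in> tangent_space reduced_space p"
  by (simp add: tangent_space_reduced_space)

lemma covec_inner_proj:
  assumes p: "p \<in> reduced_space" and a: "a \<in> cotangent_space reduced_space p"
  shows "covec p a \<bullet> v = a (tangent_proj p v)"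
proof -
  have lin: "linear (\<lambda>v. a (tangent_proj p v))"
    using a tangent_proj_tangent[OF p] unfolding cotangent_space_def
    by (intro linearI) (simp_all add: linear_add[OF linear_tangent_proj] linear_cmul[OF linear_tangent_proj])
  have "covec p a \<bullet> v = (\<Sum>b\<in>Basis. (v \<bullet> b) *\<^sub>R a (tangent_proj p b))"
    by (simp add: covec_def inner_sum_left inner_commute[of v] mult.commute)
  also have "\<dots> = a (tangent_proj p (\<Sum>b\<in>Basis. (v \<bullet> b) *\<^sub>R b))"
    by (simp only: linear_sum[OF lin] linear_cmul[OF lin])
  finally show ?thesis
    by (simp only: euclidean_representation)
qed

lemma covec_inner:
  assumes "p \<in> reduced_space" "a \<in> cotangent_space reduced_space p" "v \<in> tangent_space reduced_space p"
  shows "covec p a \<bullet> v = a v"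
  using covec_inner_proj[OF assms(1,2)] tangent_proj_id[OF assms(1,3)] by simp

lemma cotangent_space_innerI:
  assumes "p \<in> reduced_space"
  shows "(\<lambda>v. if v \<in> tangent_space reduced_space p then e \<bullet> v else 0) \<in> cotangent_space reduced_space p"
  using tangent_space_add[OF assms] tangent_space_scaleR[OF assms]
  unfolding cotangent_space_def by (simp add: inner_add_right)

lemma covec_linear: "covec p (\<lambda>v. s * a v + t * b v) = s *\<^sub>R covec p a + t *\<^sub>R covec p b"
  by (simp add: covec_def scaleR_add_left sum.distrib scaleR_sum_right)

text \<open>The coordinates of the representative are values of \<open>\<alpha>\<close> on the
  projected constant fields, and smoothness of a one-form is defined through such values.\<close>

lemma smooth_map_covec:
  assumes "\<alpha> \<in> one_forms reduced_space"
  shows "smooth_map reduced_space (\<lambda>p. covec p (\<alpha> p))"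
proof -
  have "\<forall>X\<in>vector_fields reduced_space. smooth_map reduced_space (\<lambda>p. \<alpha> p (X p))"
    using assms unfolding one_forms_def by blast
  from bspec[OF this tangent_proj_vector_field] show ?thesis
    unfolding covec_def by (intro smooth_map_sum smooth_map_scaleR smooth_map_const)
qed

lemma one_formsI:
  assumes "smooth_map reduced_space e"
    and "\<And>p. p \<in> reduced_space \<Longrightarrow> \<alpha> p = (\<lambda>v. if v \<in> tangent_space reduced_space p then e p \<bullet> v else 0)"
  shows "\<alpha> \<in> one_forms reduced_space"
proof -
  have "smooth_map reduced_space (\<lambda>p. \<alpha> p (X p))" if "X \<in> vector_fields reduced_space" for X
  proof (rule smooth_map_cong[of _ "\<lambda>p. e p \<bullet> X p"])
    show "smooth_map reduced_space (\<lambda>p. e p \<bullet> X p)"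
      using that assms(1) unfolding vector_fields_def by (intro smooth_map_inner) auto
  qed (use that assms(2) in \<open>auto simp: vector_fields_def\<close>)
  then show ?thesis
    using assms(2) cotangent_space_innerI unfolding one_forms_def by auto
qed

lemma differential_one_form:
  assumes "smooth_map reduced_space f"
  shows "differential reduced_space f \<in> one_forms reduced_space"
proof -
  have "linear (frechet_derivative f (at p within reduced_space))" if "p \<in> reduced_space" for p
    using smooth_map_has_derivative[OF assms that] has_derivative_linear by blast
  then have "differential reduced_space f p \<in> cotangent_space reduced_space p" if "p \<in> reduced_space" for p
    using that tangent_space_add[OF that] tangent_space_scaleR[OF that]
    unfolding cotangent_space_def differential_def by (simp add: linear_add linear_cmul)
  moreover have "smooth_map reduced_space (\<lambda>p. differential reduced_space f p (X p))"
    if "X \<in> vector_fields reduced_space" for X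
    by (rule smooth_map_cong[OF smooth_map_deriv_along[OF assms that]])
      (use that in \<open>auto simp: vector_fields_def differential_def deriv_along_def\<close>)
  ultimately show ?thesis
    unfolding one_forms_def by blast
qed

section \<open>The bivector field\<close>

text \<open>This is \<open>\<pi>\<^sup>\<sharp>\<close> for covectors given by ambient vectors. It is defined for all vectors, and two vectors
  that agree as covectors differ by a multiple of \<open>(fst p, 0)\<close>, which it annihilates.\<close>

definition bracket_map :: "(vec3 \<times> vec3 \<Rightarrow> real) \<Rightarrow> vec3 \<times> vec3 \<Rightarrow> vec3 \<times> vec3 \<Rightarrow> vec3 \<times> vec3" where
  "bracket_map c p a = (snd a \<times> fst p, fst a \<times> fst p + snd a \<times> (snd p + c p *\<^sub>R fst p))"

definition bracket_bivector ::
    "(vec3 \<times> vec3 \<Rightarrow> real) \<Rightarrow> vec3 \<times> vec3 \<Rightarrow> (vec3 \<times> vec3 \<Rightarrow> real) \<Rightarrow> (vec3 \<times> vec3 \<Rightarrow> real) \<Rightarrow> real" where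
  "bracket_bivector c p a b = bracket_map c p (covec p a) \<bullet> covec p b"

lemma linear_bracket_map: "linear (bracket_map c p)"
  by (rule linearI)
    (simp_all add: bracket_map_def cross_add_left cross_mult_left algebra_simps)

lemma bracket_map_tangent: "p \<in> reduced_space \<Longrightarrow> bracket_map c p a \<in> tangent_space reduced_space p"
  by (simp add: tangent_space_reduced_space bracket_map_def dot_cross_self)

text \<open>As a block matrix the map consists of blocks of the form
  \<open>x \<mapsto> x \<times> y\<close>, each of them skew, and its two off-diagonal blocks
  coincide.\<close>

lemma bracket_map_skew: "bracket_map c p a \<bullet> b = - (bracket_map c p b \<bullet> a)"
proof -
  have "(x \<times> y) \<bullet> z = - ((z \<times> y) \<bullet> x)" for x y z :: vec3
    by (simp add: cross3_simps)
  from this[of "snd a" _ "fst b"] this[of "fst a" _ "snd b"] this[of "snd a" _ "snd b"] show ?thesis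
    by (simp add: bracket_map_def inner_prod_def inner_add_left)
qed

text \<open>This is the Casimir property of \<open>\<gamma> \<bullet> \<gamma>\<close>, whose
  gradient is a multiple of the normal \<open>(\<gamma>, 0)\<close>.\<close>

lemma bracket_map_cong:
  assumes p: "p \<in> reduced_space"
    and eq: "\<And>v. v \<in> tangent_space reduced_space p \<Longrightarrow> a \<bullet> v = a' \<bullet> v"
  shows "bracket_map c p a = bracket_map c p a'"
proof -
  define d where "d = a - a'"
  have pp: "fst p \<bullet> fst p = 1"
    using p reduced_space_iff by blast
  \<comment> \<open>The difference is tested against its own projection; as the projection is
    orthogonal, this inner product is the squared norm of the projection.\<close>
  have orth: "d \<bullet> tangent_proj p d = 0"
    using eq[OF tangent_proj_tangent[OF p, of d]] by (simp add: d_def inner_diff_left)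
  have "tangent_proj p d \<bullet> tangent_proj p d = d \<bullet> tangent_proj p d"
    using pp by (simp add: tangent_proj_def inner_prod_def inner_diff_left inner_diff_right inner_commute algebra_simps)
  then have "tangent_proj p d = 0"
    using orth by simp
  then have "fst d = (fst d \<bullet> fst p) *\<^sub>R fst p" "snd d = 0"
    by (simp_all add: tangent_proj_def prod_eq_iff)
  then have "bracket_map c p d = 0"
    unfolding bracket_map_def by (metis add.right_neutral cross_mult_left cross_refl cross_zero_left scaleR_zero_right zero_prod_def)
  then show ?thesis
    by (simp add: d_def linear_diff[OF linear_bracket_map])
qed

lemma bracket_bivector_eq:
  assumes "p \<in> reduced_space" "b \<in> cotangent_space reduced_space p"
  shows "bracket_bivector c p a b = b (bracket_map c p (covec p a))"
  unfolding bracket_bivector_def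
  using covec_inner[OF assms bracket_map_tangent[OF assms(1)]] by (simp add: inner_commute)

lemma sharp_bracket_bivector:
  assumes p: "p \<in> reduced_space"
  shows "sharp reduced_space (bracket_bivector c) p a = bracket_map c p (covec p a)"
  unfolding sharp_def
proof (rule the_equality)
  show "bracket_map c p (covec p a) \<in> tangent_space reduced_space p \<and>
    (\<forall>b\<in>cotangent_space reduced_space p. b (bracket_map c p (covec p a)) = bracket_bivector c p a b)"
    using bracket_map_tangent[OF p] bracket_bivector_eq[OF p] by simp
next
  fix v assume v: "v \<in> tangent_space reduced_space p \<and>
    (\<forall>b\<in>cotangent_space reduced_space p. b v = bracket_bivector c p a b)"
  define w where "w = bracket_map c p (covec p a)"
  have w: "w \<in> tangent_space reduced_space p"
    unfolding w_def by (rule bracket_map_tangent[OF p])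
  \<comment> \<open>The covector that separates \<open>v\<close> from \<open>w\<close>: paired with
    \<open>v - w\<close> it returns the squared length.\<close>
  define b where "b = (\<lambda>x. if x \<in> tangent_space reduced_space p then (v - w) \<bullet> x else 0)"
  have "b \<in> cotangent_space reduced_space p"
    unfolding b_def by (rule cotangent_space_innerI[OF p])
  then have "b v = b w"
    using v bracket_bivector_eq[OF p] by (simp add: w_def)
  then have "(v - w) \<bullet> (v - w) = 0"
    using v w by (simp add: b_def inner_diff_right)
  then show "v = bracket_map c p (covec p a)"
    by (simp add: w_def)
qed

lemma smooth_map_bracket_map:
  assumes "smooth_map reduced_space c" "smooth_map reduced_space a"
  shows "smooth_map reduced_space (\<lambda>p. bracket_map c p (a p))"
  unfolding bracket_map_def
  by (intro smooth_map_Pair smooth_map_add smooth_map_cross smooth_map_scaleR smooth_map_fst smooth_map_snd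
      smooth_map_ident assms)

lemma bracket_bivector_skew: "bracket_bivector c p a b = - bracket_bivector c p b a"
  unfolding bracket_bivector_def by (rule bracket_map_skew)

lemma bracket_bivector_linear:
  "bracket_bivector c p (\<lambda>v. s * a v + t * a' v) b = s * bracket_bivector c p a b + t * bracket_bivector c p a' b"
  by (simp add: bracket_bivector_def covec_linear linear_add[OF linear_bracket_map]
      linear_cmul[OF linear_bracket_map] inner_add_left)

lemma bivector_field_bracket_bivector:
  assumes "smooth_map reduced_space c"
  shows "bivector_field reduced_space (bracket_bivector c)"
proof -
  have "smooth_map reduced_space (\<lambda>p. bracket_bivector c p (\<alpha> p) (\<beta> p))"
    if "\<alpha> \<in> one_forms reduced_space" "\<beta> \<in> one_forms reduced_space" for \<alpha> \<beta>
    unfolding bracket_bivector_def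
    by (intro smooth_map_inner smooth_map_bracket_map smooth_map_covec that assms)
  then show ?thesis
    using bracket_bivector_skew bracket_bivector_linear
    unfolding bivector_field_def by blast
qed

lemma graph_sections_bracket_bivector:
  "(X, \<alpha>) \<in> graph_sections reduced_space (bracket_bivector c) \<longleftrightarrow>
    X \<in> vector_fields reduced_space \<and> \<alpha> \<in> one_forms reduced_space \<and>
    (\<forall>p\<in>reduced_space. X p = bracket_map c p (covec p (\<alpha> p)))"
  by (auto simp: graph_sections_def graph_fibre_def sharp_bracket_bivector one_forms_def)

text \<open>A bracket that depends on functions only through their differentials inherits linearity
  and the Leibniz rule from the differential.\<close>

lemma bivector_of_bracket_bracket_bivector:
  assumes c: "smooth_map reduced_space c"
    and br: "\<And>f g p. smooth_map reduced_space f \<Longrightarrow> smooth_map reduced_space g \<Longrightarrow> p \<in> reduced_space \<Longrightarrow>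
      br f g p = bracket_bivector c p (differential reduced_space f p) (differential reduced_space g p)"
  shows "almost_poisson_bracket reduced_space br"
    and "bivector_of_bracket reduced_space br (bracket_bivector c)"
proof -
  note bivec = bivector_field_bracket_bivector[OF c]
  show "bivector_of_bracket reduced_space br (bracket_bivector c)"
    unfolding bivector_of_bracket_def using bivec br by simp
  have lin: "differential reduced_space (\<lambda>q. s * f q + t * g q) p
      = (\<lambda>v. s * differential reduced_space f p v + t * differential reduced_space g p v)"
    if "smooth_map reduced_space f" "smooth_map reduced_space g" "p \<in> reduced_space" for f g :: "vec3 \<times> vec3 \<Rightarrow> real" and p s t
  proof
    fix v
    show "differential reduced_space (\<lambda>q. s * f q + t * g q) p v
      = s * differential reduced_space f p v + t * differential reduced_space g p v"
      using frechet_derivative_within_eq[OF has_derivative_add[OF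
          has_derivative_mult_right[OF smooth_map_has_derivative[OF that(1,3)], of s]
          has_derivative_mult_right[OF smooth_map_has_derivative[OF that(2,3)], of t]]]
      by (simp add: differential_def)
  qed
  have leib: "differential reduced_space (\<lambda>q. f q * g q) p
      = (\<lambda>v. f p * differential reduced_space g p v + g p * differential reduced_space f p v)"
    if "smooth_map reduced_space f" "smooth_map reduced_space g" "p \<in> reduced_space" for f g :: "vec3 \<times> vec3 \<Rightarrow> real" and p
  proof
    fix v
    show "differential reduced_space (\<lambda>q. f q * g q) p v
      = f p * differential reduced_space g p v + g p * differential reduced_space f p v"
      using frechet_derivative_within_eq[OF has_derivative_mult[OF
          smooth_map_has_derivative[OF that(1,3)] smooth_map_has_derivative[OF that(2,3)]]]
      by (simp add: differential_def mult.commute)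
  qed
  show "almost_poisson_bracket reduced_space br"
    unfolding almost_poisson_bracket_def
  proof (intro allI impI conjI ballI)
    fix f g :: "vec3 \<times> vec3 \<Rightarrow> real" assume fg: "smooth_map reduced_space f" "smooth_map reduced_space g"
    have "smooth_map reduced_space
      (\<lambda>p. bracket_bivector c p (differential reduced_space f p) (differential reduced_space g p))"
      using bivec differential_one_form[OF fg(1)] differential_one_form[OF fg(2)]
      unfolding bivector_field_def by blast
    then show "smooth_map reduced_space (br f g)"
      by (rule smooth_map_cong) (simp add: br fg)
    fix p assume p: "p \<in> reduced_space"
    show "br g f p = - br f g p"
      by (simp add: br fg p bracket_bivector_skew[of _ _ "differential reduced_space g p"])
    fix h :: "vec3 \<times> vec3 \<Rightarrow> real" assume h: "smooth_map reduced_space h"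
    have sm: "smooth_map reduced_space (\<lambda>q. s * f q + t * g q)" "smooth_map reduced_space (\<lambda>q. f q * g q)" for s t
      by (intro smooth_map_add smooth_map_mult smooth_map_const fg)+
    show "br (\<lambda>q. s * f q + t * g q) h p = s * br f h p + t * br g h p" for s t
      by (simp add: br sm fg h p lin bracket_bivector_linear)
    show "br (\<lambda>q. f q * g q) h p = f p * br g h p + g p * br f h p"
      by (simp add: br sm fg h p leib bracket_bivector_linear)
  qed
qed

section \<open>The three-form\<close>

lemma deriv_along_add:
  assumes "smooth_map M f" "smooth_map M g" "p \<in> M" "X \<in> vector_fields M"
  shows "deriv_along M X (\<lambda>q. f q + g q) p = deriv_along M X f p + deriv_along M X g p"
  using deriv_along_eq[of _ _ p M X, OF has_derivative_add[OF smooth_map_has_derivative smooth_map_has_derivative], OF assms(1,3,2,3)] assms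
  by (simp add: vector_fields_def deriv_along_def)

lemma deriv_along_diff:
  assumes "smooth_map M f" "smooth_map M g" "p \<in> M" "X \<in> vector_fields M"
  shows "deriv_along M X (\<lambda>q. f q - g q) p = deriv_along M X f p - deriv_along M X g p"
  using deriv_along_eq[of _ _ p M X, OF has_derivative_diff[OF smooth_map_has_derivative smooth_map_has_derivative], OF assms(1,3,2,3)] assms
  by (simp add: vector_fields_def deriv_along_def)

lemma area_form_skew: "area_form p u v = - area_form p v u"
  by (simp add: area_form_def cross_skew[of "fst u"])

lemma area_form_diff_left: "area_form p (u - u') v = area_form p u v - area_form p u' v"
  by (simp add: area_form_def Cross3.left_diff_distrib inner_diff_right)

lemma area_form_linear_left: "area_form p (s *\<^sub>R u + t *\<^sub>R u') v = s * area_form p u v + t * area_form p u' v"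
  by (simp add: area_form_def cross_add_left cross_mult_left inner_add_right)

lemma smooth_map_area_form:
  assumes "smooth_map M X" "smooth_map M Y"
  shows "smooth_map M (\<lambda>p. area_form p (X p) (Y p))"
  unfolding area_form_def by (intro smooth_map_inner smooth_map_cross smooth_map_fst smooth_map_ident assms)

text \<open>The derivative of the area form itself does not contribute since three tangent vectors of the
  sphere are linearly dependent.\<close>

lemma deriv_along_area_form:
  assumes f: "smooth_map reduced_space f" and X: "X \<in> vector_fields reduced_space"
    and Y: "Y \<in> vector_fields reduced_space" and Z: "Z \<in> vector_fields reduced_space"
    and p: "p \<in> reduced_space"
  shows "deriv_along reduced_space X (\<lambda>q. f q * area_form q (Y q) (Z q)) p =
    deriv_along reduced_space X f p * area_form p (Y p) (Z p)
    + f p * (area_form p (deriv_along reduced_space X Y p) (Z p)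
           + area_form p (Y p) (deriv_along reduced_space X Z p))"
proof -
  have tan: "X p \<in> tangent_space reduced_space p" "Y p \<in> tangent_space reduced_space p"
    "Z p \<in> tangent_space reduced_space p" and sm: "smooth_map reduced_space Y" "smooth_map reduced_space Z"
    using X Y Z p unfolding vector_fields_def by auto
  show ?thesis
    unfolding area_form_def
    by (subst deriv_along_eq[of _ _ p reduced_space X, OF has_derivative_mult[OF smooth_map_has_derivative[OF f p]
          has_derivative_inner[OF has_derivative_fst[OF has_derivative_ident]
            has_derivative_cross[OF has_derivative_fst[OF smooth_map_has_derivative[OF sm(1) p]]
              has_derivative_fst[OF smooth_map_has_derivative[OF sm(2) p]]]]] tan(1)])
      (simp add: tangent_triple_product[OF p tan] deriv_along_def inner_add_right algebra_simps)
qed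

text \<open>The wedge product of \<open>dc\<close> and \<open>\<sigma>\<close> on three vectors.
  Unlike \<open>ext_deriv2\<close> it involves no extension of these vectors to fields.\<close>

definition dc_sigma ::
    "(vec3 \<times> vec3 \<Rightarrow> real) \<Rightarrow> vec3 \<times> vec3 \<Rightarrow> vec3 \<times> vec3 \<Rightarrow> vec3 \<times> vec3 \<Rightarrow> vec3 \<times> vec3 \<Rightarrow> real" where
  "dc_sigma c p u v w =
     frechet_derivative c (at p within reduced_space) u * area_form p v w
     - frechet_derivative c (at p within reduced_space) v * area_form p u w
     + frechet_derivative c (at p within reduced_space) w * area_form p u v"

lemma ext_deriv2_area_form:
  assumes c: "smooth_map reduced_space c" and p: "p \<in> reduced_space"
    and tan: "u \<in> tangent_space reduced_space p" "v \<in> tangent_space reduced_space p"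
      "w \<in> tangent_space reduced_space p"
  shows "ext_deriv2 reduced_space (\<lambda>p u v. c p * area_form p u v) p u v w = dc_sigma c p u v w"
proof -
  define U V W where "U = extend_vector reduced_space p u" and "V = extend_vector reduced_space p v"
    and "W = extend_vector reduced_space p w"
  have fields: "U \<in> vector_fields reduced_space" "V \<in> vector_fields reduced_space" "W \<in> vector_fields reduced_space"
    and at: "U p = u" "V p = v" "W p = w"
    unfolding U_def V_def W_def using extend_vector_reduced_space[OF p] tan by auto
  \<comment> \<open>Derivatives of the chosen fields are moved to the first slot of the area form,
    where those from the Lie brackets already stand. Fixing one argument keeps the rewriting from
    looping.\<close>
  note skew = area_form_skew[of p v] area_form_skew[of p u]
  show ?thesis
    unfolding ext_deriv2_def U_def[symmetric] V_def[symmetric] W_def[symmetric] ext_deriv2_fields_def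
      deriv_along_area_form[OF c fields(1,2,3) p] deriv_along_area_form[OF c fields(2,1,3) p]
      deriv_along_area_form[OF c fields(3,1,2) p] lie_bracket_def area_form_diff_left at
      skew[of "deriv_along reduced_space _ _ p"]
    by (simp add: dc_sigma_def deriv_along_def at algebra_simps)
qed

lemma dc_sigma_fields:
  "dc_sigma c p (X p) (Y p) (Z p) =
     deriv_along reduced_space X c p * area_form p (Y p) (Z p)
     - deriv_along reduced_space Y c p * area_form p (X p) (Z p)
     + deriv_along reduced_space Z c p * area_form p (X p) (Y p)"
  by (simp add: dc_sigma_def deriv_along_def)

lemma smooth_map_dc_sigma:
  assumes c: "smooth_map reduced_space c" and X: "X \<in> vector_fields reduced_space"
    and Y: "Y \<in> vector_fields reduced_space" and Z: "Z \<in> vector_fields reduced_space"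
  shows "smooth_map reduced_space (\<lambda>p. dc_sigma c p (X p) (Y p) (Z p))"
proof -
  have "smooth_map reduced_space X" "smooth_map reduced_space Y" "smooth_map reduced_space Z"
    using X Y Z unfolding vector_fields_def by auto
  then show ?thesis
    unfolding dc_sigma_fields
    by (intro smooth_map_add smooth_map_diff smooth_map_mult smooth_map_deriv_along[OF c] smooth_map_area_form X Y Z)
qed

lemma deriv_along_dc_sigma:
  assumes c: "smooth_map reduced_space c" and X: "X \<in> vector_fields reduced_space"
    and Y: "Y \<in> vector_fields reduced_space" and Z: "Z \<in> vector_fields reduced_space"
    and W: "W \<in> vector_fields reduced_space" and p: "p \<in> reduced_space"
  shows "deriv_along reduced_space W (\<lambda>p. dc_sigma c p (X p) (Y p) (Z p)) p =
     deriv_along reduced_space W (\<lambda>q. deriv_along reduced_space X c q * area_form q (Y q) (Z q)) p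
     - deriv_along reduced_space W (\<lambda>q. deriv_along reduced_space Y c q * area_form q (X q) (Z q)) p
     + deriv_along reduced_space W (\<lambda>q. deriv_along reduced_space Z c q * area_form q (X q) (Y q)) p"
proof -
  have sm: "smooth_map reduced_space X" "smooth_map reduced_space Y" "smooth_map reduced_space Z"
    using X Y Z unfolding vector_fields_def by auto
  have summand: "smooth_map reduced_space (\<lambda>q. deriv_along reduced_space S c q * area_form q (T q) (U q))"
    if "S \<in> vector_fields reduced_space" "smooth_map reduced_space T" "smooth_map reduced_space U" for S T U
    using that by (intro smooth_map_mult smooth_map_deriv_along[OF c] smooth_map_area_form)
  show ?thesis
    unfolding dc_sigma_fields
    by (simp add: deriv_along_add deriv_along_diff smooth_map_diff p W summand sm X Y Z)
qed

text \<open>The four outer derivatives produce twelve second derivatives of \<open>c\<close>. They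
  pair up to six commutators, which \<open>commute\<close> matches with the six bracket terms; the
  derivatives of the fields cancel as well.\<close>

lemma ext_deriv3_dc_sigma:
  assumes c: "smooth_map reduced_space c"
    and commute: "\<And>X Y p. X \<in> vector_fields reduced_space \<Longrightarrow> Y \<in> vector_fields reduced_space \<Longrightarrow> p \<in> reduced_space \<Longrightarrow>
      deriv_along reduced_space (lie_bracket reduced_space X Y) c p =
      deriv_along reduced_space X (deriv_along reduced_space Y c) p
      - deriv_along reduced_space Y (deriv_along reduced_space X c) p"
    and X: "X \<in> vector_fields reduced_space"
    and Y: "Y \<in> vector_fields reduced_space" and Z: "Z \<in> vector_fields reduced_space"
    and W: "W \<in> vector_fields reduced_space" and p: "p \<in> reduced_space"
  shows "ext_deriv3_fields reduced_space (dc_sigma c) X Y Z W p = 0"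
proof -
  note dd = deriv_along_area_form[OF smooth_map_deriv_along[OF c]]
  note skew = area_form_skew[of p "X p" "deriv_along _ _ _ _"] area_form_skew[of p "Y p" "deriv_along _ _ _ _"]
    area_form_skew[of p "Z p" "deriv_along _ _ _ _"] area_form_skew[of p "W p" "deriv_along _ _ _ _"]
  have lie: "area_form p (lie_bracket reduced_space U V p) w =
      area_form p (deriv_along reduced_space U V p) w - area_form p (deriv_along reduced_space V U p) w" for U V w
    by (simp add: lie_bracket_def area_form_diff_left)
  have br: "dc_sigma c p (lie_bracket reduced_space U V p) (S p) (T p) =
      (deriv_along reduced_space U (deriv_along reduced_space V c) p
        - deriv_along reduced_space V (deriv_along reduced_space U c) p) * area_form p (S p) (T p)
      - deriv_along reduced_space S c p * (area_form p (deriv_along reduced_space U V p) (T p)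
         - area_form p (deriv_along reduced_space V U p) (T p))
      + deriv_along reduced_space T c p * (area_form p (deriv_along reduced_space U V p) (S p)
         - area_form p (deriv_along reduced_space V U p) (S p))"
    if "U \<in> vector_fields reduced_space" "V \<in> vector_fields reduced_space" for U V S T
    unfolding dc_sigma_fields[of c p "lie_bracket reduced_space U V"] lie commute[OF that p] ..
  show ?thesis
    unfolding ext_deriv3_fields_def
      deriv_along_dc_sigma[OF c Y Z W X p] deriv_along_dc_sigma[OF c X Z W Y p]
      deriv_along_dc_sigma[OF c X Y W Z p] deriv_along_dc_sigma[OF c X Y Z W p]
      br[OF X Y] br[OF X Z] br[OF X W] br[OF Y Z] br[OF Y W] br[OF Z W]
      dd[OF Y X Z W p] dd[OF Z X Y W p] dd[OF W X Y Z p]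
      dd[OF X Y Z W p] dd[OF Z Y X W p] dd[OF W Y X Z p]
      dd[OF X Z Y W p] dd[OF Y Z X W p] dd[OF W Z X Y p]
      dd[OF X W Y Z p] dd[OF Y W X Z p] dd[OF Z W X Y p]
      skew
    by (simp add: algebra_simps)
qed

text \<open>Agreement is asked on tangent vectors only, since \<open>extend_vector\<close> has no
  field to pick for other vectors. This suffices because fields and their Lie brackets are
  tangent.\<close>

lemma closed_three_form_eq_dc_sigma:
  assumes c: "smooth_map reduced_space c"
    and commute: "\<And>X Y p. X \<in> vector_fields reduced_space \<Longrightarrow> Y \<in> vector_fields reduced_space \<Longrightarrow> p \<in> reduced_space \<Longrightarrow>
      deriv_along reduced_space (lie_bracket reduced_space X Y) c p =
      deriv_along reduced_space X (deriv_along reduced_space Y c) p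
      - deriv_along reduced_space Y (deriv_along reduced_space X c) p"
    and eq: "\<And>p u v w. p \<in> reduced_space \<Longrightarrow> u \<in> tangent_space reduced_space p \<Longrightarrow> v \<in> tangent_space reduced_space p \<Longrightarrow>
      w \<in> tangent_space reduced_space p \<Longrightarrow> \<phi> p u v w = dc_sigma c p u v w"
  shows "closed_three_form reduced_space \<phi>"
  unfolding closed_three_form_def three_forms_def mem_Collect_eq
proof (intro conjI ballI allI)
  fix p u v w
  assume p: "p \<in> reduced_space" and tan: "u \<in> tangent_space reduced_space p"
    "v \<in> tangent_space reduced_space p" "w \<in> tangent_space reduced_space p"
  have lin: "linear (frechet_derivative c (at p within reduced_space))"
    using smooth_map_has_derivative[OF c p] has_derivative_linear by blast
  show "\<phi> p (s *\<^sub>R u + t *\<^sub>R u') v w = s * \<phi> p u v w + t * \<phi> p u' v w"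
    if "u' \<in> tangent_space reduced_space p" for u' s t
    by (simp add: eq p tan that tangent_space_add tangent_space_scaleR dc_sigma_def linear_add[OF lin]
        linear_cmul[OF lin] area_form_linear_left algebra_simps)
  show "\<phi> p v u w = - \<phi> p u v w"
    by (simp add: eq p tan dc_sigma_def area_form_skew[of p v u])
  show "\<phi> p u w v = - \<phi> p u v w"
    by (simp add: eq p tan dc_sigma_def area_form_skew[of p w v])
next
  fix X Y Z assume f: "X \<in> vector_fields reduced_space" "Y \<in> vector_fields reduced_space" "Z \<in> vector_fields reduced_space"
  show "smooth_map reduced_space (\<lambda>p. \<phi> p (X p) (Y p) (Z p))"
    by (rule smooth_map_cong[OF smooth_map_dc_sigma[OF c f]])
      (use f in \<open>auto simp: eq vector_fields_def\<close>)
next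
  fix X Y Z W p
  assume f: "X \<in> vector_fields reduced_space" "Y \<in> vector_fields reduced_space" "Z \<in> vector_fields reduced_space"
    "W \<in> vector_fields reduced_space" and p: "p \<in> reduced_space"
  have tan: "V q \<in> tangent_space reduced_space q"
    if "V \<in> vector_fields reduced_space" "q \<in> reduced_space" for V q
    using that unfolding vector_fields_def by blast
  have cong: "deriv_along reduced_space V (\<lambda>q. \<phi> q (S q) (T q) (U q)) p
      = deriv_along reduced_space V (\<lambda>q. dc_sigma c q (S q) (T q) (U q)) p"
    if "S \<in> vector_fields reduced_space" "T \<in> vector_fields reduced_space" "U \<in> vector_fields reduced_space" for V S T U
    using eq tan that by (intro deriv_along_cong[OF _ p]) blast
  have "ext_deriv3_fields reduced_space \<phi> X Y Z W p = ext_deriv3_fields reduced_space (dc_sigma c) X Y Z W p"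
    unfolding ext_deriv3_fields_def by (simp add: cong f eq p tan lie_bracket_vector_fields)
  then show "ext_deriv3_fields reduced_space \<phi> X Y Z W p = 0"
    using ext_deriv3_dc_sigma[OF c commute f p] by simp
qed

section \<open>The Courant bracket of two sections of the graph\<close>

text \<open>The derivative at \<open>p\<close> in direction \<open>h\<close> of
  \<open>q \<mapsto> bracket_map c q a\<close> with the vector \<open>a\<close> held fixed.\<close>

definition bracket_map_deriv :: "(vec3 \<times> vec3 \<Rightarrow> real) \<Rightarrow> vec3 \<times> vec3 \<Rightarrow> vec3 \<times> vec3 \<Rightarrow> vec3 \<times> vec3 \<Rightarrow> vec3 \<times> vec3" where
  "bracket_map_deriv c p a h = (snd a \<times> fst h,
     fst a \<times> fst h + snd a \<times> (snd h + frechet_derivative c (at p within reduced_space) h *\<^sub>R fst p + c p *\<^sub>R fst h))"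

lemma deriv_bracket_map:
  assumes c: "smooth_map reduced_space c" and a: "smooth_map reduced_space a" and p: "p \<in> reduced_space"
    and X: "\<And>q. q \<in> reduced_space \<Longrightarrow> X q = bracket_map c q (a q)" and w: "w \<in> tangent_space reduced_space p"
  shows "frechet_derivative X (at p within reduced_space) w =
    bracket_map c p (frechet_derivative a (at p within reduced_space) w) + bracket_map_deriv c p (a p) w"
proof -
  let ?D = "\<lambda>h. bracket_map c p (frechet_derivative a (at p within reduced_space) h) + bracket_map_deriv c p (a p) h"
  note da = smooth_map_has_derivative[OF a p] and dc = smooth_map_has_derivative[OF c p]
  have "((\<lambda>q. bracket_map c q (a q)) has_derivative
      (\<lambda>h. (snd (a p) \<times> fst h + snd (frechet_derivative a (at p within reduced_space) h) \<times> fst p,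
        (fst (a p) \<times> fst h + fst (frechet_derivative a (at p within reduced_space) h) \<times> fst p) +
        (snd (a p) \<times> (snd h + (c p *\<^sub>R fst h + frechet_derivative c (at p within reduced_space) h *\<^sub>R fst p)) +
         snd (frechet_derivative a (at p within reduced_space) h) \<times> (snd p + c p *\<^sub>R fst p)))))
      (at p within reduced_space)"
    unfolding bracket_map_def
    by (intro has_derivative_Pair has_derivative_add has_derivative_cross has_derivative_scaleR
        has_derivative_fst has_derivative_snd has_derivative_ident da dc)
  moreover have "(snd (a p) \<times> fst h + snd (frechet_derivative a (at p within reduced_space) h) \<times> fst p,
        (fst (a p) \<times> fst h + fst (frechet_derivative a (at p within reduced_space) h) \<times> fst p) +
        (snd (a p) \<times> (snd h + (c p *\<^sub>R fst h + frechet_derivative c (at p within reduced_space) h *\<^sub>R fst p)) +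
         snd (frechet_derivative a (at p within reduced_space) h) \<times> (snd p + c p *\<^sub>R fst p))) = ?D h" for h
    by (simp add: bracket_map_def bracket_map_deriv_def ac_simps)
  ultimately have "((\<lambda>q. bracket_map c q (a q)) has_derivative ?D) (at p within reduced_space)"
    by simp
  then have "(X has_derivative ?D) (at p within reduced_space)"
    by (rule has_derivative_transform[rotated 2]) (use p X in auto)
  from frechet_derivative_within_eq[OF this w] show ?thesis .
qed

text \<open>The Jacobi identity, oriented so that rewriting nests all products to the right.\<close>

lemma cross_cross_left: "(x \<times> y) \<times> z = x \<times> (y \<times> z) - y \<times> (x \<times> z)" for x y z :: vec3
  using Jacobi[of x y z] cross_skew[of z "x \<times> y"] cross_skew[of z x] by (simp add: algebra_simps)

text \<open>The part of the one-form of the Courant bracket in which the sections \<open>a\<close>, \<open>b\<close> are not differentiated;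
  \<open>r\<close> and \<open>s\<close> stand for \<open>dc(X)\<close> and \<open>dc(Y)\<close>.\<close>

definition courant_covector ::
    "(vec3 \<times> vec3 \<Rightarrow> real) \<Rightarrow> vec3 \<times> vec3 \<Rightarrow> vec3 \<times> vec3 \<Rightarrow> vec3 \<times> vec3 \<Rightarrow> real \<Rightarrow> real \<Rightarrow> vec3 \<times> vec3" where
  "courant_covector c p a b r s =
    (fst b \<times> snd a + snd b \<times> fst a + c p *\<^sub>R (snd b \<times> snd a) + r *\<^sub>R snd b - s *\<^sub>R snd a, snd b \<times> snd a)"

text \<open>The tangent-vector half of the closure condition. Its \<open>dc\<close> terms match
  directly, as \<open>(snd b, 0)\<close> is mapped to \<open>(0, snd b \<times> fst p)\<close>; the
  rest is the Jacobi identity.\<close>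

lemma bracket_map_courant_covector:
  assumes "X = bracket_map c p a" "Y = bracket_map c p b"
    and "r = frechet_derivative c (at p within reduced_space) X"
    and "s = frechet_derivative c (at p within reduced_space) Y"
  shows "bracket_map c p (courant_covector c p a b r s) = bracket_map_deriv c p b X - bracket_map_deriv c p a Y"
proof -
  have XY: "fst X = snd a \<times> fst p" "snd X = fst a \<times> fst p + snd a \<times> (snd p + c p *\<^sub>R fst p)"
    "fst Y = snd b \<times> fst p" "snd Y = fst b \<times> fst p + snd b \<times> (snd p + c p *\<^sub>R fst p)"
    using assms by (simp_all add: bracket_map_def)
  \<comment> \<open>Vectors carry a componentwise product, so collecting like terms can yield a
    vector numeral; it is turned into a scalar for the cross product rules.\<close>
  have double: "2 * v = 2 *\<^sub>R v" for v :: vec3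
    by (simp add: scaleR_2)
  show ?thesis
    unfolding bracket_map_deriv_def assms(3,4)[symmetric] bracket_map_def courant_covector_def
    by (simp add: XY double cross_cross_left cross_add_left cross_add_right cross_mult_left cross_mult_right
        Cross3.left_diff_distrib algebra_simps)
qed

text \<open>The covector half of the closure condition. The first two terms of the twist yield
  \<open>r *\<^sub>R snd b - s *\<^sub>R snd a\<close>; the third cancels the \<open>dc(w)\<close>
  term of \<open>bracket_map_deriv\<close>.\<close>

lemma courant_covector_inner:
  assumes p: "p \<in> reduced_space" and w: "w \<in> tangent_space reduced_space p"
    and X: "X = bracket_map c p a" and Y: "Y = bracket_map c p b"
    and r: "r = frechet_derivative c (at p within reduced_space) X"
    and s: "s = frechet_derivative c (at p within reduced_space) Y"
  shows "courant_covector c p a b r s \<bullet> w = b \<bullet> bracket_map_deriv c p a w + dc_sigma c p X Y w"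
proof -
  have XY: "fst X = snd a \<times> fst p" "fst Y = snd b \<times> fst p"
    using X Y by (simp_all add: bracket_map_def)
  have pw: "fst p \<bullet> fst p = 1" "fst p \<bullet> fst w = 0"
    using p w tangent_space_reduced_space[OF p] by (simp_all add: reduced_space_iff inner_commute)
  have triple: "x \<bullet> (y \<times> z) = (x \<times> y) \<bullet> z" for x y z :: vec3
    by (simp add: cross3_simps)
  \<comment> \<open>The area form undoes the quarter turn \<open>x \<times> fst p\<close>, so
    \<open>\<sigma>(X, w)\<close> and \<open>\<sigma>(Y, w)\<close> are pairings of
    \<open>fst w\<close> with \<open>snd a\<close> and \<open>snd b\<close>.\<close>
  have area: "fst p \<bullet> ((x \<times> fst p) \<times> v) = x \<bullet> v" if "fst p \<bullet> v = 0" for x v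
  proof -
    have "fst p \<bullet> ((x \<times> fst p) \<times> v) = (x \<times> fst p) \<bullet> (v \<times> fst p)"
      by (simp add: cross3_simps)
    then show ?thesis
      using pw(1) that by (simp add: dot_cross)
  qed
  have sigma: "area_form p Y w = snd b \<bullet> fst w" "area_form p X w = snd a \<bullet> fst w"
    "area_form p X Y = snd a \<bullet> (snd b \<times> fst p)"
    unfolding area_form_def XY using pw area by (simp_all add: dot_cross_self)
  have flip: "snd b \<bullet> (snd a \<times> fst p) = - (snd a \<bullet> (snd b \<times> fst p))"
    by (simp add: cross3_simps)
  show ?thesis
    unfolding dc_sigma_def sigma r[symmetric] s[symmetric]
    by (simp add: courant_covector_def bracket_map_deriv_def inner_prod_def inner_add_left inner_diff_left
        inner_add_right cross_add_right cross_mult_right triple flip[unfolded triple] algebra_simps)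
qed

text \<open>The derivative of the auxiliary field \<open>W\<close> occurs both in the product rule
  for \<open>\<beta>(W)\<close> and in the Lie bracket, and cancels. What is left depends on
  \<open>w\<close> alone.\<close>

lemma lie_deriv1_reduced_space:
  assumes b: "smooth_map reduced_space b"
    and \<beta>: "\<And>q v. q \<in> reduced_space \<Longrightarrow> v \<in> tangent_space reduced_space q \<Longrightarrow> \<beta> q v = b q \<bullet> v"
    and X: "X \<in> vector_fields reduced_space" and p: "p \<in> reduced_space" and w: "w \<in> tangent_space reduced_space p"
  shows "lie_deriv1 reduced_space X \<beta> p w =
    deriv_along reduced_space X b p \<bullet> w + b p \<bullet> frechet_derivative X (at p within reduced_space) w"
proof -
  define W where "W = extend_vector reduced_space p w"
  have W: "W \<in> vector_fields reduced_space" "W p = w"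
    using extend_vector_reduced_space[OF p w] by (simp_all add: W_def)
  then have sm: "smooth_map reduced_space W" and tan: "\<And>q. q \<in> reduced_space \<Longrightarrow> W q \<in> tangent_space reduced_space q"
    by (auto simp: vector_fields_def)
  have Xp: "X p \<in> tangent_space reduced_space p"
    using X p by (auto simp: vector_fields_def)
  have lie: "lie_bracket reduced_space X W p \<in> tangent_space reduced_space p"
    using lie_bracket_vector_fields[OF X W(1)] p by (auto simp: vector_fields_def)
  have "deriv_along reduced_space X (\<lambda>q. \<beta> q (W q)) p = deriv_along reduced_space X (\<lambda>q. b q \<bullet> W q) p"
    by (rule deriv_along_cong[OF _ p]) (simp add: \<beta> tan)
  also have "\<dots> = b p \<bullet> deriv_along reduced_space X W p + deriv_along reduced_space X b p \<bullet> w"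
    using deriv_along_eq[of _ _ p reduced_space X,
        OF has_derivative_inner[OF smooth_map_has_derivative[OF b p] smooth_map_has_derivative[OF sm p]] Xp]
    by (simp add: deriv_along_def W)
  finally show ?thesis
    unfolding lie_deriv1_def W_def[symmetric] lie_deriv1_fields_def \<beta>[OF p lie]
    by (simp add: lie_bracket_def inner_diff_right) (simp add: deriv_along_def W)
qed

lemma ext_deriv1_reduced_space:
  assumes a: "smooth_map reduced_space a"
    and \<alpha>: "\<And>q v. q \<in> reduced_space \<Longrightarrow> v \<in> tangent_space reduced_space q \<Longrightarrow> \<alpha> q v = a q \<bullet> v"
    and p: "p \<in> reduced_space" and u: "u \<in> tangent_space reduced_space p" and v: "v \<in> tangent_space reduced_space p"
  shows "ext_deriv1 reduced_space \<alpha> p u v =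
    frechet_derivative a (at p within reduced_space) u \<bullet> v - frechet_derivative a (at p within reduced_space) v \<bullet> u"
proof -
  define U V where "U = extend_vector reduced_space p u" and "V = extend_vector reduced_space p v"
  have fields: "U \<in> vector_fields reduced_space" "V \<in> vector_fields reduced_space" and at: "U p = u" "V p = v"
    using extend_vector_reduced_space[OF p] u v by (simp_all add: U_def V_def)
  have der: "deriv_along reduced_space S (\<lambda>q. \<alpha> q (T q)) p
      = a p \<bullet> deriv_along reduced_space S T p + frechet_derivative a (at p within reduced_space) (S p) \<bullet> T p"
    if S: "S \<in> vector_fields reduced_space" and T: "T \<in> vector_fields reduced_space" for S T
  proof -
    have sm: "smooth_map reduced_space T" and Sp: "S p \<in> tangent_space reduced_space p"
      and tan: "\<And>q. q \<in> reduced_space \<Longrightarrow> T q \<in> tangent_space reduced_space q"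
      using S T p by (auto simp: vector_fields_def)
    have "deriv_along reduced_space S (\<lambda>q. \<alpha> q (T q)) p = deriv_along reduced_space S (\<lambda>q. a q \<bullet> T q) p"
      by (rule deriv_along_cong[OF _ p]) (simp add: \<alpha> tan)
    also have "\<dots> = a p \<bullet> deriv_along reduced_space S T p + frechet_derivative a (at p within reduced_space) (S p) \<bullet> T p"
      using deriv_along_eq[of _ _ p reduced_space S,
          OF has_derivative_inner[OF smooth_map_has_derivative[OF a p] smooth_map_has_derivative[OF sm p]] Sp]
      by (simp add: deriv_along_def)
    finally show ?thesis .
  qed
  have lie: "lie_bracket reduced_space U V p \<in> tangent_space reduced_space p"
    using lie_bracket_vector_fields[OF fields] p by (auto simp: vector_fields_def)
  show ?thesis
    unfolding ext_deriv1_def U_def[symmetric] V_def[symmetric] ext_deriv1_fields_def \<alpha>[OF p lie]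
      der[OF fields] der[OF fields(2,1)] at
    by (simp add: lie_bracket_def inner_diff_right)
qed

theorem courant_bracket_graph_sections:
  assumes c: "smooth_map reduced_space c"
    and \<phi>: "\<And>p u v w. p \<in> reduced_space \<Longrightarrow> u \<in> tangent_space reduced_space p \<Longrightarrow> v \<in> tangent_space reduced_space p \<Longrightarrow>
      w \<in> tangent_space reduced_space p \<Longrightarrow> \<phi> p u v w = dc_sigma c p u v w"
    and e: "e1 \<in> graph_sections reduced_space (bracket_bivector c)" "e2 \<in> graph_sections reduced_space (bracket_bivector c)"
  shows "courant_bracket reduced_space \<phi> e1 e2 \<in> graph_sections reduced_space (bracket_bivector c)"
proof -
  obtain X \<alpha> Y \<beta> where e12: "e1 = (X, \<alpha>)" "e2 = (Y, \<beta>)"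
    by fastforce
  define a b where "a q = covec q (\<alpha> q)" and "b q = covec q (\<beta> q)" for q
  have X: "X \<in> vector_fields reduced_space" "\<And>q. q \<in> reduced_space \<Longrightarrow> X q = bracket_map c q (a q)"
    and Y: "Y \<in> vector_fields reduced_space" "\<And>q. q \<in> reduced_space \<Longrightarrow> Y q = bracket_map c q (b q)"
    and forms: "\<alpha> \<in> one_forms reduced_space" "\<beta> \<in> one_forms reduced_space"
    using e unfolding e12 graph_sections_bracket_bivector a_def b_def by auto
  have ab: "smooth_map reduced_space a" "smooth_map reduced_space b"
    unfolding a_def b_def by (intro smooth_map_covec forms)+
  have rep: "\<alpha> q v = a q \<bullet> v" "\<beta> q v = b q \<bullet> v"
    if "q \<in> reduced_space" "v \<in> tangent_space reduced_space q" for q v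
    using that forms unfolding a_def b_def one_forms_def by (auto simp: covec_inner)
  define L where "L = lie_bracket reduced_space X Y"
  define \<xi> where "\<xi> p w = (if w \<in> tangent_space reduced_space p
      then lie_deriv1 reduced_space X \<beta> p w - ext_deriv1 reduced_space \<alpha> p (Y p) w + \<phi> p (X p) (Y p) w else 0)" for p w
  \<comment> \<open>A smooth ambient representative of the covector part, in the form suggested by
    the two lemmas on \<open>courant_covector\<close>.\<close>
  define e where "e p = deriv_along reduced_space X b p - deriv_along reduced_space Y a p
      + courant_covector c p (a p) (b p) (deriv_along reduced_space X c p) (deriv_along reduced_space Y c p)" for p
  have smooth_e: "smooth_map reduced_space e"
    unfolding e_def courant_covector_def
    by (intro smooth_map_add smooth_map_diff smooth_map_Pair smooth_map_scaleR smooth_map_cross smooth_map_fst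
        smooth_map_snd smooth_map_deriv_along c ab X(1) Y(1))
  have tan: "X p \<in> tangent_space reduced_space p" "Y p \<in> tangent_space reduced_space p" if "p \<in> reduced_space" for p
    using X(1) Y(1) that by (auto simp: vector_fields_def)
  have DX: "frechet_derivative X (at p within reduced_space) w =
       bracket_map c p (frechet_derivative a (at p within reduced_space) w) + bracket_map_deriv c p (a p) w"
    and DY: "frechet_derivative Y (at p within reduced_space) w =
       bracket_map c p (frechet_derivative b (at p within reduced_space) w) + bracket_map_deriv c p (b p) w"
    if "p \<in> reduced_space" "w \<in> tangent_space reduced_space p" for p w
    by (rule deriv_bracket_map[OF c ab(1) that(1) X(2) that(2)], assumption)
      (rule deriv_bracket_map[OF c ab(2) that(1) Y(2) that(2)])
  have \<xi>: "\<xi> p w = e p \<bullet> w" if p: "p \<in> reduced_space" and w: "w \<in> tangent_space reduced_space p" for p w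
  proof -
    note DX = DX[OF p w]
    \<comment> \<open>Applied to the derivative of \<open>a\<close>, this makes the Lie derivative
      term cancel against the exterior derivative.\<close>
    have skew: "b p \<bullet> bracket_map c p z = - (z \<bullet> Y p)" for z
      using bracket_map_skew[of c p z "b p"] by (simp add: Y(2)[OF p] inner_commute)
    have "courant_covector c p (a p) (b p) (deriv_along reduced_space X c p) (deriv_along reduced_space Y c p) \<bullet> w
       = b p \<bullet> bracket_map_deriv c p (a p) w + dc_sigma c p (X p) (Y p) w"
      by (rule courant_covector_inner[OF p w X(2)[OF p] Y(2)[OF p]]) (simp_all add: deriv_along_def)
    then show ?thesis
      using w lie_deriv1_reduced_space[OF ab(2) rep(2) X(1) p w]
        ext_deriv1_reduced_space[OF ab(1) rep(1) p tan(2)[OF p] w] \<phi>[OF p tan[OF p] w]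
      by (simp add: \<xi>_def e_def DX inner_add_left inner_add_right inner_diff_left skew)
        (simp add: deriv_along_def)
  qed
  have \<xi>_form: "\<xi> \<in> one_forms reduced_space"
  proof (rule one_formsI[OF smooth_e], rule ext)
    fix p v assume "p \<in> reduced_space"
    then show "\<xi> p v = (if v \<in> tangent_space reduced_space p then e p \<bullet> v else 0)"
      using \<xi>[of p v] by (cases "v \<in> tangent_space reduced_space p") (simp_all add: \<xi>_def)
  qed
  have "L p = bracket_map c p (covec p (\<xi> p))" if p: "p \<in> reduced_space" for p
  proof -
    have "\<xi> p \<in> cotangent_space reduced_space p"
      using \<xi>_form p unfolding one_forms_def by blast
    \<comment> \<open>The two representatives may differ by a normal vector, so their images are
      compared instead.\<close>
    then have "bracket_map c p (covec p (\<xi> p)) = bracket_map c p (e p)"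
      using p by (intro bracket_map_cong) (simp_all add: covec_inner \<xi>)
    also have "\<dots> = bracket_map c p (deriv_along reduced_space X b p) - bracket_map c p (deriv_along reduced_space Y a p)
        + (bracket_map_deriv c p (b p) (X p) - bracket_map_deriv c p (a p) (Y p))"
      unfolding e_def linear_add[OF linear_bracket_map] linear_diff[OF linear_bracket_map]
      by (subst bracket_map_courant_covector[OF X(2)[OF p] Y(2)[OF p]]) (simp_all add: deriv_along_def)
    also have "\<dots> = L p"
      by (simp add: L_def lie_bracket_def deriv_along_def DX[OF p tan(2)[OF p]] DY[OF p tan(1)[OF p]])
    finally show ?thesis ..
  qed
  then have "(L, \<xi>) \<in> graph_sections reduced_space (bracket_bivector c)"
    unfolding graph_sections_bracket_bivector using \<xi>_form lie_bracket_vector_fields[OF X(1) Y(1)] L_def by simp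
  moreover have "courant_bracket reduced_space \<phi> e1 e2 = (L, \<xi>)"
    unfolding courant_bracket_def e12 L_def \<xi>_def[abs_def] by simp
  ultimately show ?thesis
    by simp
qed

section \<open>The rank one bracket\<close>

text \<open>With \<open>A\<close> the inverse inertia tensor and \<open>\<rho> = m * r\<^sup>2\<close> this is \<open>m * r\<^sup>2 * (\<Omega> \<bullet> \<gamma>)\<close>, obtained by solving the
  equation that defines \<open>\<Omega>\<close>.\<close>

definition spin :: "real \<Rightarrow> real^3^3 \<Rightarrow> vec3 \<times> vec3 \<Rightarrow> real" where
  "spin \<rho> A p = \<rho> * ((A *v snd p) \<bullet> fst p) * inverse (1 + \<rho> * ((A *v fst p) \<bullet> fst p))"

text \<open>The ambient gradient of \<open>c = spin \<rho> A\<close>, found by differentiating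
  \<open>c D = \<rho> (A K \<bullet> \<gamma>)\<close> with \<open>D\<close> the denominator.
  Keeping \<open>c\<close> in the formula lets its derivative be expressed through the gradient
  again.\<close>

definition spin_grad :: "real \<Rightarrow> real^3^3 \<Rightarrow> vec3 \<times> vec3 \<Rightarrow> vec3 \<times> vec3" where
  "spin_grad \<rho> A p = inverse (1 + \<rho> * ((A *v fst p) \<bullet> fst p)) *\<^sub>R
     (\<rho> *\<^sub>R (A *v snd p - (2 * spin \<rho> A p) *\<^sub>R (A *v fst p)), \<rho> *\<^sub>R (A *v fst p))"

lemmas has_derivative_matrix_vector_mult = bounded_linear.has_derivative[OF matrix_vector_mul_bounded_linear]

lemma spin_denominator_pos:
  assumes "\<rho> > 0" "\<And>u. 0 \<le> (A *v u) \<bullet> u"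
  shows "1 + \<rho> * ((A *v u) \<bullet> u) > 0"
  using assms by (simp add: add_pos_nonneg)

lemma smooth_map_spin:
  assumes "\<rho> > 0" "\<And>u. 0 \<le> (A *v u) \<bullet> u"
  shows "smooth_map M (spin \<rho> A)"
proof -
  have "1 + \<rho> * ((A *v u) \<bullet> u) \<noteq> 0" for u
    using spin_denominator_pos[OF assms] by (metis less_irrefl)
  then show ?thesis
    unfolding spin_def[abs_def]
    by (intro smooth_map_mult smooth_map_inverse smooth_map_add smooth_map_inner smooth_map_const
        smooth_map_bounded_linear[OF matrix_vector_mul_bounded_linear] smooth_map_fst smooth_map_snd smooth_map_ident)
qed

lemma spin_has_derivative:
  assumes rho: "\<rho> > 0" and pos: "\<And>u. 0 \<le> (A *v u) \<bullet> u" and sym: "\<And>u v. (A *v u) \<bullet> v = (A *v v) \<bullet> u"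
  shows "(spin \<rho> A has_derivative (\<lambda>h. spin_grad \<rho> A p \<bullet> h)) (at p within M)"
proof -
  define D where "D = 1 + \<rho> * ((A *v fst p) \<bullet> fst p)"
  have D: "D \<noteq> 0"
    using spin_denominator_pos[OF rho pos] unfolding D_def by (metis less_irrefl)
  have "(spin \<rho> A has_derivative (\<lambda>h. \<rho> * ((A *v snd p) \<bullet> fst p) *
        - (inverse D * (\<rho> * ((A *v fst p) \<bullet> fst h + (A *v fst h) \<bullet> fst p)) * inverse D)
      + \<rho> * ((A *v snd p) \<bullet> fst h + (A *v snd h) \<bullet> fst p) * inverse D)) (at p within M)"
    unfolding spin_def[abs_def] D_def
    by (rule derivative_eq_intros has_derivative_matrix_vector_mult refl | use D in \<open>simp add: D_def\<close>)+
  moreover have "\<rho> * ((A *v snd p) \<bullet> fst p) *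
        - (inverse D * (\<rho> * ((A *v fst p) \<bullet> fst h + (A *v fst h) \<bullet> fst p)) * inverse D)
      + \<rho> * ((A *v snd p) \<bullet> fst h + (A *v snd h) \<bullet> fst p) * inverse D = spin_grad \<rho> A p \<bullet> h" for h
    unfolding spin_grad_def spin_def D_def[symmetric] sym[of "fst h" "fst p"] sym[of "snd h" "fst p"]
    by (simp add: inner_prod_def inner_diff_left algebra_simps)
  ultimately show ?thesis
    by simp
qed

text \<open>\<open>H\<close> is the Hessian of \<open>spin\<close>; its symmetry, checked on the
  formula, lets second derivatives be interchanged.\<close>

lemma spin_grad_has_derivative:
  assumes rho: "\<rho> > 0" and pos: "\<And>u. 0 \<le> (A *v u) \<bullet> u" and sym: "\<And>u v. (A *v u) \<bullet> v = (A *v v) \<bullet> u"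
  obtains H where "(spin_grad \<rho> A has_derivative H) (at p within M)" "\<And>h k. H h \<bullet> k = H k \<bullet> h"
proof -
  define D where "D = 1 + \<rho> * ((A *v fst p) \<bullet> fst p)"
  have D: "D \<noteq> 0"
    using spin_denominator_pos[OF rho pos] unfolding D_def by (metis less_irrefl)
  define H where "H h = inverse D *\<^sub>R (\<rho> *\<^sub>R (A *v snd h - ((2 * spin \<rho> A p) *\<^sub>R (A *v fst h)
        + (2 * (spin_grad \<rho> A p \<bullet> h)) *\<^sub>R (A *v fst p))), \<rho> *\<^sub>R (A *v fst h))
      + (- (inverse D * (\<rho> * ((A *v fst p) \<bullet> fst h + (A *v fst h) \<bullet> fst p)) * inverse D)) *\<^sub>R
        (\<rho> *\<^sub>R (A *v snd p - (2 * spin \<rho> A p) *\<^sub>R (A *v fst p)), \<rho> *\<^sub>R (A *v fst p))" for h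
  have "((\<lambda>q. inverse (1 + \<rho> * ((A *v fst q) \<bullet> fst q))) has_derivative
      (\<lambda>h. - (inverse D * (\<rho> * ((A *v fst p) \<bullet> fst h + (A *v fst h) \<bullet> fst p)) * inverse D))) (at p within M)"
    unfolding D_def
    by (rule derivative_eq_intros has_derivative_matrix_vector_mult refl | use D in \<open>simp add: D_def\<close>)+
  moreover have "((\<lambda>q. (\<rho> *\<^sub>R (A *v snd q - (2 * spin \<rho> A q) *\<^sub>R (A *v fst q)), \<rho> *\<^sub>R (A *v fst q))) has_derivative
      (\<lambda>h. (\<rho> *\<^sub>R (A *v snd h - ((2 * spin \<rho> A p) *\<^sub>R (A *v fst h)
        + (2 * (spin_grad \<rho> A p \<bullet> h)) *\<^sub>R (A *v fst p))), \<rho> *\<^sub>R (A *v fst h)))) (at p within M)"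
    by (intro has_derivative_Pair has_derivative_scaleR_right has_derivative_diff has_derivative_scaleR
        has_derivative_mult_right has_derivative_matrix_vector_mult has_derivative_fst has_derivative_snd
        has_derivative_ident spin_has_derivative[OF rho pos sym])
  ultimately have "((\<lambda>q. inverse (1 + \<rho> * ((A *v fst q) \<bullet> fst q)) *\<^sub>R
      (\<rho> *\<^sub>R (A *v snd q - (2 * spin \<rho> A q) *\<^sub>R (A *v fst q)), \<rho> *\<^sub>R (A *v fst q))) has_derivative H) (at p within M)"
    unfolding H_def[abs_def] by (rule has_derivative_scaleR[THEN has_derivative_eq_rhs]) (simp add: D_def)
  then have der: "(spin_grad \<rho> A has_derivative H) (at p within M)"
    by (simp only: spin_grad_def[symmetric])
  \<comment> \<open>Once \<open>spin_grad\<close> is recognised in the derivative of the inverse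
    denominator, exchanging \<open>h\<close> and \<open>k\<close> merely swaps terms: those linear
    in \<open>A\<close> by its symmetry, and the two products of \<open>spin_grad\<close> with
    \<open>A *v fst p\<close>.\<close>
  have H_eq: "H h = inverse D *\<^sub>R (\<rho> *\<^sub>R (A *v snd h - ((2 * spin \<rho> A p) *\<^sub>R (A *v fst h)
        + (2 * (spin_grad \<rho> A p \<bullet> h)) *\<^sub>R (A *v fst p))), \<rho> *\<^sub>R (A *v fst h))
      - (inverse D * 2 * \<rho> * ((A *v fst p) \<bullet> fst h)) *\<^sub>R spin_grad \<rho> A p" for h
    unfolding H_def spin_grad_def[of \<rho> A p] D_def[symmetric] sym[of "fst h" "fst p"]
    by (simp add: algebra_simps)
  have "H h \<bullet> k = H k \<bullet> h" for h k
    unfolding H_eq by (simp add: inner_prod_def[of "(_, _)"] inner_add_left inner_diff_left sym[of "snd h"] sym[of "fst h" "fst k"]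
      sym[of "snd k"] algebra_simps)
  then show thesis
    by (rule that[OF der])
qed

text \<open>The product rule gives \<open>G \<bullet> D_X Y + H(X) \<bullet> Y\<close> for the
  iterated derivative. The Hessian part is symmetric and drops out of the commutator.\<close>

lemma deriv_along_lie_bracket:
  assumes c: "\<And>q. q \<in> M \<Longrightarrow> (c has_derivative (\<lambda>h. G q \<bullet> h)) (at q within M)"
    and G: "(G has_derivative H) (at p within M)" and sym: "\<And>h k. H h \<bullet> k = H k \<bullet> h"
    and X: "X \<in> vector_fields M" and Y: "Y \<in> vector_fields M" and p: "p \<in> M"
    and lie: "lie_bracket M X Y p \<in> tangent_space M p"
  shows "deriv_along M (lie_bracket M X Y) c p =
    deriv_along M X (deriv_along M Y c) p - deriv_along M Y (deriv_along M X c) p"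
proof -
  have first: "deriv_along M U c q = G q \<bullet> U q" if "q \<in> M" "U q \<in> tangent_space M q" for U q
    using deriv_along_eq[OF c[OF that(1)], of U] that(2) by simp
  have second: "deriv_along M U (deriv_along M V c) p = G p \<bullet> deriv_along M U V p + H (U p) \<bullet> V p"
    if U: "U \<in> vector_fields M" and V: "V \<in> vector_fields M" for U V
  proof -
    have UV: "U p \<in> tangent_space M p" "smooth_map M V" "\<And>q. q \<in> M \<Longrightarrow> V q \<in> tangent_space M q"
      using U V p by (auto simp: vector_fields_def)
    have "deriv_along M U (deriv_along M V c) p = deriv_along M U (\<lambda>q. G q \<bullet> V q) p"
      by (rule deriv_along_cong[OF _ p]) (simp add: first UV(3))
    also have "\<dots> = G p \<bullet> deriv_along M U V p + H (U p) \<bullet> V p"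
      using deriv_along_eq[of _ _ p M U, OF has_derivative_inner[OF G smooth_map_has_derivative[OF UV(2) p]] UV(1)]
      by (simp add: deriv_along_def)
    finally show ?thesis .
  qed
  show ?thesis
    unfolding second[OF X Y] second[OF Y X] first[of p "lie_bracket M X Y", OF p lie] sym[of "X p" "Y p"]
    by (simp add: lie_bracket_def inner_diff_right)
qed

section \<open>The diagonal inertia tensor and the equation for \<open>\<Omega>\<close>\<close>

lemma diag3_mult_vec: "(diag3 a b c *v w) $ 1 = a * w $ 1" "(diag3 a b c *v w) $ 2 = b * w $ 2"
  "(diag3 a b c *v w) $ 3 = c * w $ 3"
  by (simp_all add: diag3_def matrix_vector_mult_def sum_3 vector_def)

lemma diag3_inner: "(diag3 a b c *v u) \<bullet> v = a * u $ 1 * v $ 1 + b * u $ 2 * v $ 2 + c * u $ 3 * v $ 3"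
  by (simp add: inner_vec_def sum_3 diag3_mult_vec)

text \<open>With \<open>t = \<rho> * (w \<bullet> \<gamma>)\<close> the defining equation reads
  \<open>w = A (K - t \<gamma>)\<close>. Pairing with \<open>\<gamma>\<close> leaves one scalar
  linear equation for \<open>t\<close> with positive leading coefficient, hence existence and
  uniqueness of \<open>w\<close>.\<close>

lemma Omega_inner:
  assumes rho: "m * r\<^sup>2 > 0" and pos: "\<And>u. 0 \<le> (A *v u) \<bullet> u"
    and inv: "\<And>u. A *v (\<I> *v u) = u" "\<And>u. \<I> *v (A *v u) = u"
  shows "m * r\<^sup>2 * (Omega m r \<I> p \<bullet> fst p) = spin (m * r\<^sup>2) A p"
proof -
  define g K \<rho> s where "g = fst p" and "K = snd p" and "\<rho> = m * r\<^sup>2" and "s = spin \<rho> A p"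
  have "1 + \<rho> * ((A *v g) \<bullet> g) \<noteq> 0"
    using spin_denominator_pos[OF rho pos] unfolding \<rho>_def by (metis less_irrefl)
  then have s: "t = \<rho> * ((A *v K) \<bullet> g) - t * \<rho> * ((A *v g) \<bullet> g) \<longleftrightarrow> t = s" for t
    unfolding s_def spin_def g_def[symmetric] K_def[symmetric] by (auto simp: field_simps)
  have inner: "\<rho> * ((A *v (K - t *\<^sub>R g)) \<bullet> g) = \<rho> * ((A *v K) \<bullet> g) - t * \<rho> * ((A *v g) \<bullet> g)" for t
    by (simp add: matrix_vector_mult_diff_distrib matrix_vector_mult_scaleR inner_diff_left algebra_simps)
  have "Omega m r \<I> p = (THE w. K = \<I> *v w + (\<rho> * (w \<bullet> g)) *\<^sub>R g)"
    by (simp add: Omega_def g_def K_def \<rho>_def case_prod_beta)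
  also have "\<dots> = A *v (K - s *\<^sub>R g)"
  proof (rule the_equality)
    show "K = \<I> *v (A *v (K - s *\<^sub>R g)) + (\<rho> * ((A *v (K - s *\<^sub>R g)) \<bullet> g)) *\<^sub>R g"
      using s[of s] inner[of s] by (simp add: inv)
  next
    fix w assume w: "K = \<I> *v w + (\<rho> * (w \<bullet> g)) *\<^sub>R g"
    then have "\<I> *v w = K - (\<rho> * (w \<bullet> g)) *\<^sub>R g"
      by (simp add: algebra_simps)
    then have *: "w = A *v (K - (\<rho> * (w \<bullet> g)) *\<^sub>R g)"
      using inv(1)[of w] by simp
    then have "\<rho> * (w \<bullet> g) = s"
      using inner[of "\<rho> * (w \<bullet> g)"] s by metis
    then show "w = A *v (K - s *\<^sub>R g)"
      using * by simp
  qed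
  finally have "\<rho> * (Omega m r \<I> p \<bullet> g) = s"
    using s[of s] inner[of s] by simp
  then show ?thesis
    by (simp only: g_def \<rho>_def s_def)
qed

section \<open>Gradients of extensions and the bracket formula\<close>

lemma linear_vec_axis:
  fixes f :: "vec3 \<Rightarrow> real"
  assumes "linear f"
  shows "(\<chi> i. f (axis i 1)) \<bullet> v = f v"
proof -
  have "f v = f (\<Sum>i\<in>UNIV. v $ i *\<^sub>R axis i 1)"
    using basis_expansion[of v] by (simp add: scalar_mult_eq_scaleR)
  then show ?thesis
    by (simp add: linear_sum[OF assms] linear_cmul[OF assms] inner_vec_def mult.commute)
qed

lemma grad_inner:
  assumes "F differentiable (at p)"
  shows "(grad_gamma F p, grad_K F p) \<bullet> v = frechet_derivative F (at p) v"
proof -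
  have lin: "linear (frechet_derivative F (at p))"
    using assms by (rule linear_frechet_derivative)
  have "linear (\<lambda>u. frechet_derivative F (at p) (u, 0))" "linear (\<lambda>u. frechet_derivative F (at p) (0, u))"
    using linear_add[OF lin, of "(_, 0)" "(_, 0)"] linear_add[OF lin, of "(0, _)" "(0, _)"]
      linear_cmul[OF lin, of _ "(_, 0)"] linear_cmul[OF lin, of _ "(0, _)"]
    by (auto intro!: linearI)
  from this[THEN linear_vec_axis] show ?thesis
    using linear_add[OF lin, of "(fst v, 0)" "(0, snd v)"]
    by (simp add: inner_prod_def grad_gamma_def grad_K_def)
qed

lemma rank1_formula_bracket_map:
  assumes "c p = m * r\<^sup>2 * (Omega m r \<I> p \<bullet> fst p)"
  shows "rank1_formula m r \<I> F G p = bracket_map c p (grad_gamma F p, grad_K F p) \<bullet> (grad_gamma G p, grad_K G p)"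
proof -
  have "- L \<bullet> (a \<times> b) - g \<bullet> (a \<times> b' - b \<times> a') = (a \<times> g) \<bullet> b' + (a' \<times> g + a \<times> L) \<bullet> b"
    for L a b g a' b' :: vec3
    by (simp add: cross3_simps)
  from this[of "snd p + c p *\<^sub>R fst p"] show ?thesis
    unfolding rank1_formula_def prod.case_eq_if prod.collapse
    by (simp add: bracket_map_def inner_prod_def assms)
qed

text \<open>The gradient of a chosen extension agrees with \<open>covec\<close> on tangent vectors
  only. In the first argument this is enough because \<open>bracket_map\<close> kills normal
  vectors, in the second because its values are tangent.\<close>

lemma rank1_bracket_bivector:
  assumes c: "c p = m * r\<^sup>2 * (Omega m r \<I> p \<bullet> fst p)"
    and f: "smooth_map reduced_space f" and g: "smooth_map reduced_space g" and p: "p \<in> reduced_space"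
  shows "rank1_bracket m r \<I> f g p = bracket_bivector c p (differential reduced_space f p) (differential reduced_space g p)"
proof -
  have ext: "(grad_gamma (SOME F. local_extension reduced_space p h F) p,
      grad_K (SOME F. local_extension reduced_space p h F) p) \<bullet> v = covec p (differential reduced_space h p) \<bullet> v"
    if h: "smooth_map reduced_space h" and v: "v \<in> tangent_space reduced_space p" for h :: "vec3 \<times> vec3 \<Rightarrow> real" and v
  proof -
    have "local_extension reduced_space p h (SOME F. local_extension reduced_space p h F)"
      using h p someI_ex[of "local_extension reduced_space p h"] unfolding smooth_map_def by blast
    note local_extension_frechet_derivative[OF this p v]
    moreover have "differential reduced_space h p \<in> cotangent_space reduced_space p"
      using differential_one_form[OF h] p unfolding one_forms_def by blast
    ultimately show ?thesis
      using v by (simp add: grad_inner covec_inner[OF p] differential_def)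
  qed
  have "bracket_map c p (grad_gamma (SOME F. local_extension reduced_space p f F) p,
      grad_K (SOME F. local_extension reduced_space p f F) p)
    = bracket_map c p (covec p (differential reduced_space f p))"
    by (rule bracket_map_cong[OF p ext[OF f]])
  moreover have "v \<bullet> (grad_gamma (SOME F. local_extension reduced_space p g F) p,
      grad_K (SOME F. local_extension reduced_space p g F) p) = v \<bullet> covec p (differential reduced_space g p)"
    if "v \<in> tangent_space reduced_space p" for v
    using ext[OF g that] by (simp only: inner_commute[of v])
  ultimately show ?thesis
    unfolding rank1_bracket_def rank1_formula_bracket_map[where c = c, OF c] bracket_bivector_def
    by (simp only: bracket_map_tangent[OF p])
qed

theorem theorem5p8:
  fixes m r I1 I2 I3 :: real
  assumes "m > 0" and "r > 0" and "I1 > 0" and "I2 > 0" and "I3 > 0"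
  shows "twisted_poisson_bracket reduced_space
           (rank1_bracket m r (diag3 I1 I2 I3))
           (ext_deriv2 reduced_space (B_form m r (diag3 I1 I2 I3)))"
proof -
  define \<I> A \<rho> where "\<I> = diag3 I1 I2 I3" and "A = diag3 (1 / I1) (1 / I2) (1 / I3)" and "\<rho> = m * r\<^sup>2"
  have rho: "\<rho> > 0"
    using assms by (simp add: \<rho>_def)
  have pos: "0 \<le> (A *v u) \<bullet> u" for u
    using assms by (simp add: A_def diag3_inner)
  have sym: "(A *v u) \<bullet> v = (A *v v) \<bullet> u" for u v
    by (simp add: A_def diag3_inner mult.commute)
  have inv: "A *v (\<I> *v u) = u" "\<I> *v (A *v u) = u" for u
    using assms by (simp_all add: vec_eq_iff forall_3 A_def \<I>_def diag3_mult_vec)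
  have spin: "spin \<rho> A p = m * r\<^sup>2 * (Omega m r \<I> p \<bullet> fst p)" for p
    using Omega_inner[of m r A \<I>, OF _ pos inv] rho by (simp add: \<rho>_def)
  have smooth: "smooth_map reduced_space (spin \<rho> A)"
    by (rule smooth_map_spin[OF rho pos])
  have commute: "deriv_along reduced_space (lie_bracket reduced_space X Y) (spin \<rho> A) p =
      deriv_along reduced_space X (deriv_along reduced_space Y (spin \<rho> A)) p
      - deriv_along reduced_space Y (deriv_along reduced_space X (spin \<rho> A)) p"
    if "X \<in> vector_fields reduced_space" "Y \<in> vector_fields reduced_space" "p \<in> reduced_space" for X Y p
  proof -
    obtain H where "(spin_grad \<rho> A has_derivative H) (at p within reduced_space)" "\<And>h k. H h \<bullet> k = H k \<bullet> h"
      using spin_grad_has_derivative[OF rho pos sym] by blast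
    moreover have "lie_bracket reduced_space X Y p \<in> tangent_space reduced_space p"
      using lie_bracket_vector_fields[OF that(1,2)] that(3) by (auto simp: vector_fields_def)
    ultimately show ?thesis
      using deriv_along_lie_bracket[OF spin_has_derivative[OF rho pos sym]] that by blast
  qed
  \<comment> \<open>The equality holds at every ambient point, so \<open>B_form\<close> can be
    replaced as a function under \<open>ext_deriv2\<close>.\<close>
  have B: "B_form m r \<I> = (\<lambda>p u v. spin \<rho> A p * area_form p u v)"
    by (simp add: B_form_def fun_eq_iff spin)
  have \<phi>: "ext_deriv2 reduced_space (B_form m r \<I>) p u v w = dc_sigma (spin \<rho> A) p u v w"
    if "p \<in> reduced_space" "u \<in> tangent_space reduced_space p" "v \<in> tangent_space reduced_space p"
      "w \<in> tangent_space reduced_space p" for p u v w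
    unfolding B by (rule ext_deriv2_area_form[OF smooth that])
  have br: "rank1_bracket m r \<I> f g p =
      bracket_bivector (spin \<rho> A) p (differential reduced_space f p) (differential reduced_space g p)"
    if "smooth_map reduced_space f" "smooth_map reduced_space g" "p \<in> reduced_space" for f g p
    by (rule rank1_bracket_bivector[where c = "spin \<rho> A", OF spin that])
  have "almost_poisson_bracket reduced_space (rank1_bracket m r \<I>)"
    and "bivector_of_bracket reduced_space (rank1_bracket m r \<I>) (bracket_bivector (spin \<rho> A))"
    using bivector_of_bracket_bracket_bivector[where br = "rank1_bracket m r \<I>", OF smooth br] by blast+
  moreover have "closed_three_form reduced_space (ext_deriv2 reduced_space (B_form m r \<I>))"
    by (rule closed_three_form_eq_dc_sigma[OF smooth commute \<phi>])
  moreover have "courant_bracket reduced_space (ext_deriv2 reduced_space (B_form m r \<I>)) e1 e2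
      \<in> graph_sections reduced_space (bracket_bivector (spin \<rho> A))"
    if "e1 \<in> graph_sections reduced_space (bracket_bivector (spin \<rho> A))"
      "e2 \<in> graph_sections reduced_space (bracket_bivector (spin \<rho> A))" for e1 e2
    by (rule courant_bracket_graph_sections[OF smooth \<phi> that])
  ultimately show ?thesis
    unfolding twisted_poisson_bracket_def \<I>_def by blast
qed

end
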